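(* Let $X$ be a complex hereditarily indecomposable Banach space, let $Y$ be a subspace of $X$, and let $I : Y \to X$ denote the inclusion map. Then every operator $T : Y \to X$ is of the form $T = \lambda I + S$, where $\lambda \in \mathbb{C}$ and $S : Y \to X$ is strictly singular.
   Context: Conventions: "space" and "subspace" always mean infinite-dimensional space and infinite-dimensional closed subspace; "operator" means bounded linear map. A Banach space $X$ is hereditarily indecomposable (H.I.) if it is infinite-dimensional and no two (closed infinite-dimensional) subspaces of $X$ are in a direct sum, i.e. there are no closed infinite-dimensional subspaces $Y, Z$ of $X$ with $Y\cap Z=\{0\}$ and $Y+Z$ closed. An operator is strictly singular if its restriction to any closed infinite-dimensional subspace of its domain is not an isomorphism onto its image. *)

theory Defs
  imports "HOL-Analysis.Analysis"
begin

class complex_normed_vector = real_normed_vector +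
  fixes scaleC :: "complex \<Rightarrow> 'a \<Rightarrow> 'a"  (infixr "*\<^sub>C" 75)
  assumes scaleC_add_right: "a *\<^sub>C (x + y) = a *\<^sub>C x + a *\<^sub>C y"
    and scaleC_add_left: "(a + b) *\<^sub>C x = a *\<^sub>C x + b *\<^sub>C x"
    and scaleC_scaleC: "a *\<^sub>C b *\<^sub>C x = (a * b) *\<^sub>C x"
    and scaleC_of_real: "complex_of_real r *\<^sub>C x = r *\<^sub>R x"
    and norm_scaleC: "norm (a *\<^sub>C x) = cmod a * norm x"

class complex_banach = complex_normed_vector + banach

lemma scaleC_one: "1 *\<^sub>C x = (x :: 'a::complex_normed_vector)"
  using scaleC_of_real[of 1 x] by simp

global_interpretation complex_vector:
  vector_space "scaleC :: complex \<Rightarrow> 'a \<Rightarrow> 'a::complex_normed_vector"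
  by unfold_locales
    (simp_all add: scaleC_add_right scaleC_add_left scaleC_scaleC scaleC_one)

definition infinite_dimensional :: "'a::complex_normed_vector set \<Rightarrow> bool" where
  "infinite_dimensional V \<longleftrightarrow> \<not> (\<exists>B. finite B \<and> complex_vector.span B = V)"

definition closed_inf_subspace :: "'a::complex_normed_vector set \<Rightarrow> bool" where
  "closed_inf_subspace V \<longleftrightarrow>
     complex_vector.subspace V \<and> closed V \<and> infinite_dimensional V"

definition hereditarily_indecomposable :: "'a::complex_banach set \<Rightarrow> bool" where
  "hereditarily_indecomposable X \<longleftrightarrow>
     closed_inf_subspace X \<and>
     \<not> (\<exists>Y Z. Y \<subseteq> X \<and> Z \<subseteq> X \<and> closed_inf_subspace Y \<and> closed_inf_subspace Z \<and>
           Y \<inter> Z = {0} \<and> closed {y + z | y z. y \<in> Y \<and> z \<in> Z})"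

text \<open>Maps defined on a subspace are represented by total functions, of which only the
  values on that subspace matter.\<close>

definition operator_on ::
  "'a::complex_normed_vector set \<Rightarrow> ('a \<Rightarrow> 'b::complex_normed_vector) \<Rightarrow> bool" where
  "operator_on V T \<longleftrightarrow>
     (\<forall>x\<in>V. \<forall>y\<in>V. T (x + y) = T x + T y) \<and>
     (\<forall>c. \<forall>x\<in>V. T (c *\<^sub>C x) = c *\<^sub>C T x) \<and>
     (\<exists>K. \<forall>x\<in>V. norm (T x) \<le> K * norm x)"

definition isomorphism_onto_image ::
  "'a::complex_normed_vector set \<Rightarrow> ('a \<Rightarrow> 'b::complex_normed_vector) \<Rightarrow> bool" where
  "isomorphism_onto_image V T \<longleftrightarrow>
     operator_on V T \<and> inj_on T V \<and> operator_on (T ` V) (inv_into V T)"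

definition strictly_singular_on ::
  "'a::complex_normed_vector set \<Rightarrow> ('a \<Rightarrow> 'b::complex_normed_vector) \<Rightarrow> bool" where
  "strictly_singular_on V S \<longleftrightarrow>
     operator_on V S \<and>
     (\<forall>Z. Z \<subseteq> V \<and> closed_inf_subspace Z \<longrightarrow> \<not> isomorphism_onto_image Z S)"

end

theory Submission
  imports Defs "HOL-Computational_Algebra.Fundamental_Theorem_Algebra"
begin

text \<open>
  Suppose that no \<open>T - \<lambda>\<close> is strictly singular, so that each is bounded below on some subspace \<open>Z \<lambda>\<close> of \<open>Y\<close>.
  In a hereditarily indecomposable space, an operator that is bounded below on a subspace \<open>A\<close> maps some smaller
  subspace of \<open>A\<close> arbitrarily close to any prescribed subspace. Hence there are unit vectors whose orbits under \<open>T\<close>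
  approximately stay, for arbitrarily many steps, in \<open>Y\<close> and in finitely many prescribed \<open>Z \<lambda>\<close>. In the limit they
  give a seminorm on the complex polynomials for which multiplication by \<open>X\<close> is bounded and, by compactness of
  a large disk, multiplication by \<open>X - \<lambda>\<close> is bounded below uniformly in \<open>\<lambda>\<close>. Such a seminorm vanishes: this
  is non-emptiness of the approximate point spectrum, proved by shrinking the spectral radius step by step with
  averages over roots of unity.
\<close>

section \<open>Operators bounded below at every scalar\<close>

text \<open>The obstacle is that \<open>T\<close> maps \<open>Y\<close> into the whole space: it has
  no powers, no resolvent and no spectrum. For an endomorphism one would take a boundary point of
  the spectrum, where T - lambda fails to be bounded below; the seminorm on polynomials makes room
  for such an argument. Nearness to the subspaces \<open>Z c\<close> is asked of orbit points only.
  A linear combination with fixed coefficients inherits it, so for a fixed polynomial p the vector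
  p(T) x is near a point of \<open>Z c\<close>, and the lower bound of T - c there passes to X - c
  with an error that vanishes in the limit. On polynomials X - a may be bounded below but is never
  onto, which rules out resolvents and forces an argument with products in place of inverses.
  Finally, the seminorm cannot vanish at 1, because the orbits start at unit vectors.\<close>

lemma monom_minus_const_eq_prod:
  fixes r :: real
  assumes "n > 0" "r > 0"
  shows "monom 1 n - [:of_real (r ^ n):] = (\<Prod>z | z ^ n = 1. [:- (of_real r * z), 1:] :: complex poly)"
proof -
  have unity: "monom 1 n - 1 = (\<Prod>z | z ^ n = 1. [:- z, 1:] :: complex poly)"
  proof -
    let ?p = "monom 1 n - 1 :: complex poly"
    have "degree ?p = n"
      using assms degree_add_eq_left[of "- 1" "monom 1 n :: complex poly"]
      by (simp add: degree_monom_eq)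
    then have lc: "lead_coeff ?p = 1"
      using assms by simp
    \<comment> \<open>The derivative vanishes at most at 0, which is not a root.\<close>
    have "rsquarefree ?p"
      using assms by (auto simp: rsquarefree_roots pderiv_diff pderiv_monom poly_monom power_0_left)
    from complex_poly_decompose_rsquarefree[OF this] lc
    show ?thesis by (simp add: poly_monom)
  qed
  \<comment> \<open>Substituting x / r reduces to the roots of unity; the factor r^n is spread over
    the n linear factors.\<close>
  have "poly (monom 1 n - [:of_real (r ^ n):]) x
      = poly (\<Prod>z | z ^ n = 1. [:- (of_real r * z), 1:]) x" for x :: complex
  proof -
    let ?r = "of_real r :: complex"
    have r: "?r \<noteq> 0" using assms by simp
    have "poly (monom 1 n - [:of_real (r ^ n):]) x = ?r ^ n * poly (monom 1 n - 1) (x / ?r)"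
      using r by (simp add: poly_monom field_simps)
    also have "\<dots> = ?r ^ n * (\<Prod>z | z ^ n = 1. (x / ?r - z))"
      by (simp add: unity poly_prod)
    also have "\<dots> = (\<Prod>z::complex | z ^ n = 1. ?r * (x / ?r - z))"
      using card_roots_unity_eq[OF assms(1)] by (simp add: prod.distrib)
    also have "\<dots> = poly (\<Prod>z | z ^ n = 1. [:- (?r * z), 1:]) x"
      using r by (simp add: poly_prod algebra_simps)
    finally show ?thesis .
  qed
  then show ?thesis
    using poly_eq_poly_eq_iff by blast
qed

text \<open>The Lagrange identity at the points \<open>r * z\<close>: each summand is \<open>X\<close> times the partial product minus the full
  product, and the partial products add up to the derivative of the full one.\<close>

lemma sum_partial_products:
  fixes r :: real
  assumes "n > 0" "r > 0"
  defines "S \<equiv> {z::complex. z ^ n = 1}"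
  shows "(\<Sum>z\<in>S. smult (of_real r * z) (\<Prod>w\<in>S - {z}. [:- (of_real r * w), 1:])) = [:of_nat n * of_real (r ^ n):]"
proof -
  let ?q = "monom 1 n - [:of_real (r ^ n):] :: complex poly"
  let ?f = "\<lambda>z. [:- (of_real r * z), 1:] :: complex poly"
  let ?P = "\<lambda>z. prod ?f (S - {z})"
  have fin: "finite S" and card: "card S = n"
    using assms card_roots_unity_eq[OF assms(1)] by (auto simp: S_def finite_roots_unity)
  have q: "?q = prod ?f S"
    using monom_minus_const_eq_prod[OF assms(1,2)] by (simp add: S_def)
  have "(\<Sum>z\<in>S. ?P z) = pderiv ?q"
    unfolding q by (simp add: pderiv_prod pderiv_pCons)
  also have "\<dots> = monom (of_nat n) (n - 1)"
    by (simp add: pderiv_diff pderiv_monom pderiv_pCons)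
  finally have sum: "(\<Sum>z\<in>S. ?P z) = monom (of_nat n) (n - 1)" .
  have "smult (of_real r * z) (?P z) = [:0,1:] * ?P z - ?q" if "z \<in> S" for z
  proof -
    have "?q = ?f z * ?P z"
      unfolding q using fin that by (simp add: prod.remove)
    also have "\<dots> = [:0,1:] * ?P z - smult (of_real r * z) (?P z)"
      by simp
    finally show ?thesis by simp
  qed
  then have "(\<Sum>z\<in>S. smult (of_real r * z) (?P z)) = (\<Sum>z\<in>S. [:0,1:] * ?P z - ?q)"
    by (rule sum.cong[OF refl])
  also have "\<dots> = [:0,1:] * monom (of_nat n) (n - 1) - of_nat n * ?q"
    by (simp only: sum_subtractf sum_distrib_left[symmetric] sum sum_constant card right_diff_distrib)
  also have "[:0,1:] * monom (of_nat n) (n - 1) = (monom (of_nat n) n :: complex poly)"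
    using assms by (cases n) (simp_all add: monom_Suc)
  also have "monom (of_nat n) n - of_nat n * ?q = [:of_nat n * of_real (r ^ n):]"
    by (simp add: of_nat_poly smult_monom algebra_simps)
  finally show ?thesis .
qed

text \<open>The model is the norm of p(T) x. The radii used below descend from \<open>K + 1\<close>,
  so \<open>lower\<close> is asked on that disk.\<close>

locale poly_seminorm =
  fixes N :: "complex poly \<Rightarrow> real" and K c :: real
  assumes triangle: "N (p + q) \<le> N p + N q"
    and smult: "N (smult a p) = cmod a * N p"
    and shift: "N ([:0, 1:] * p) \<le> K * N p"
    and lower: "cmod a \<le> K + 1 \<Longrightarrow> c * N p \<le> N ([:- a, 1:] * p)"
    and pos: "c > 0" "K \<ge> 0"
begin

lemma zero [simp]: "N 0 = 0"
  using smult[of 0 0] by simp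

lemma minus: "N (- p) = N p"
  using smult[of "-1" p] by simp

lemma nonneg: "N p \<ge> 0"
  using triangle[of p "- p"] by (simp add: minus)

lemma diff: "N (p - q) \<le> N p + N q"
  using triangle[of p "- q"] by (simp add: minus)

lemma sum_le: "N (sum f A) \<le> (\<Sum>i\<in>A. N (f i))"
proof (induction A rule: infinite_finite_induct)
  case (insert x F)
  then show ?case using triangle[of "f x" "sum f F"] by simp
qed auto

lemma power_le:
  assumes "\<And>w. N (q * w) \<le> a * N w" "a \<ge> 0"
  shows "N (q ^ m * w) \<le> a ^ m * N w"
proof (induction m)
  case (Suc m)
  have "N (q ^ Suc m * w) \<le> a * N (q ^ m * w)"
    using assms(1)[of "q ^ m * w"] by (simp add: mult.assoc)
  also have "\<dots> \<le> a * (a ^ m * N w)"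
    using Suc assms(2) by (rule mult_left_mono)
  finally show ?case by simp
qed simp

text \<open>Formally this bounds the difference of the mean values of \<open>\<lambda> (\<lambda> - X)\<inverse>\<close> over the \<open>n\<close>-th roots of unity
  scaled by \<open>r\<close> and by \<open>s\<close>. Multiplying with both \<open>X ^ n - r ^ n\<close> and \<open>X ^ n - s ^ n\<close> leaves only polynomials,
  so that lower bounds suffice and no inverses are needed. The constant does not depend on \<open>n\<close>.\<close>

lemma two_radii:
  assumes "n > 0" "0 < s" "s \<le> r" "r \<le> K + 1"
  shows "(r ^ n - s ^ n) * N (monom 1 n * w)
    \<le> K / c\<^sup>2 * (r - s) * N ((monom 1 n - [:of_real (r ^ n):]) * ((monom 1 n - [:of_real (s ^ n):]) * w))"
proof -
  define S where "S = {z::complex. z ^ n = 1}"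
  define f where "f = (\<lambda>(t::real) z::complex. [:- (of_real t * z), 1:])"
  define P where "P = (\<lambda>t z. prod (f t) (S - {z}))"
  define q where "q = (\<lambda>t. monom 1 n - [:of_real (t ^ n):] :: complex poly)"
  define v where "v = q r * (q s * w)"
  have r: "r > 0" using assms by simp
  have fin: "finite S" and card: "card S = n"
    using assms card_roots_unity_eq[OF assms(1)] by (auto simp: S_def finite_roots_unity)
  have norm1: "cmod z = 1" if "z \<in> S" for z
    using that assms(1) power_eq_imp_eq_base[of "cmod z" n 1] by (simp add: S_def flip: norm_power)
  have q: "q t = f t z * P t z" if "z \<in> S" "t > 0" for t z
    using monom_minus_const_eq_prod[OF assms(1) that(2)] fin that(1)
    unfolding q_def P_def f_def by (simp add: prod.remove S_def)
  have sum: "(\<Sum>z\<in>S. smult (of_real t * z) (P t z)) = [:of_nat n * of_real (t ^ n):]" if "t > 0" for t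
    using sum_partial_products[OF assms(1) that] unfolding S_def P_def f_def by simp
  \<comment> \<open>The contribution of z to the difference after clearing denominators. Since rz(X
    - sz) - sz(X - rz) = (r - s)zX, it carries the small factor r - s and a factor X, to which
    \<open>shift\<close> applies.\<close>
  define D where "D = (\<lambda>z. smult (of_real r * z - of_real s * z) ([:0,1:] * (P r z * P s z * w)))"
  have D: "D z = smult (of_real r * z) (P r z) * (q s * w) - smult (of_real s * z) (P s z) * (q r * w)"
    if "z \<in> S" for z
  proof -
    have f: "smult (of_real r * z) (f s z) - smult (of_real s * z) (f r z)
        = smult (of_real r * z - of_real s * z) [:0,1:]"
      by (simp add: f_def algebra_simps)
    have "smult (of_real r * z) (P r z) * (q s * w) - smult (of_real s * z) (P s z) * (q r * w)
      = (smult (of_real r * z) (f s z) - smult (of_real s * z) (f r z)) * (P r z * P s z * w)"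
      using q[OF that assms(2)] q[OF that r] by (simp add: algebra_simps)
    then show ?thesis by (simp only: f D_def mult_smult_left)
  qed
  have "(\<Sum>z\<in>S. D z) = (\<Sum>z\<in>S. smult (of_real r * z) (P r z)) * (q s * w)
      - (\<Sum>z\<in>S. smult (of_real s * z) (P s z)) * (q r * w)"
    by (simp add: D sum_subtractf sum_distrib_right)
  \<comment> \<open>Here r^n (X^n - s^n) - s^n (X^n - r^n) = (r^n - s^n) X^n.\<close>
  also have "\<dots> = smult (of_nat n * of_real (r ^ n - s ^ n)) (monom 1 n * w)"
    unfolding sum[OF r] sum[OF assms(2)] q_def
    by (simp add: algebra_simps smult_diff_left smult_diff_right)
  finally have "real n * (r ^ n - s ^ n) * N (monom 1 n * w) = N (\<Sum>z\<in>S. D z)"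
    using power_mono[OF assms(3), of n] assms(2) by (simp add: smult norm_mult del: of_real_diff)
  also have "\<dots> \<le> (\<Sum>z\<in>S. N (D z))" by (rule sum_le)
  also have "\<dots> \<le> (\<Sum>z\<in>S. K / c\<^sup>2 * (r - s) * N v)"
  proof (rule sum_mono)
    fix z assume z: "z \<in> S"
    let ?u = "P r z * P s z * w"
    have "cmod (of_real t * z) \<le> K + 1" if "t > 0" "t \<le> r" for t
      using that assms norm1[OF z] by (simp add: norm_mult)
    note b = this
    \<comment> \<open>The two factors missing from \<open>?u\<close> are restored one at a time,
      each at the cost of \<open>c\<close>; hence c^2 in the constant.\<close>
    have "c * (c * N ?u) \<le> c * N (f s z * ?u)"
      using lower[OF b[OF assms(2,3)]] pos unfolding f_def by (intro mult_left_mono) auto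
    also have "\<dots> \<le> N (f r z * (f s z * ?u))"
      using lower[OF b[OF r order_refl]] unfolding f_def by auto
    also have "f r z * (f s z * ?u) = v"
      using q[OF z r] q[OF z assms(2)] by (simp add: v_def algebra_simps)
    finally have u: "N ?u \<le> N v / c\<^sup>2"
      using pos by (simp add: power2_eq_square field_simps)
    have "cmod (of_real r * z - of_real s * z) = r - s"
      using assms norm1[OF z] by (simp add: norm_mult flip: of_real_diff left_diff_distrib)
    then have "N (D z) = (r - s) * N ([:0,1:] * ?u)"
      by (simp only: D_def smult)
    also have "\<dots> \<le> (r - s) * (K * (N v / c\<^sup>2))"
      using order_trans[OF shift mult_left_mono[OF u pos(2)]] assms by (intro mult_left_mono) auto
    finally show "N (D z) \<le> K / c\<^sup>2 * (r - s) * N v" by (simp add: mult_ac)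
  qed
  finally have "real n * ((r ^ n - s ^ n) * N (monom 1 n * w)) \<le> real n * (K / c\<^sup>2 * (r - s) * N v)"
    by (simp only: sum_constant card mult.assoc)
  with assms(1) show ?thesis
    by (simp only: v_def q_def mult_le_cancel_left_pos of_nat_0_less_iff)
qed

text \<open>The spectral radius of multiplication by \<open>X\<close> is less than \<open>r\<close>.\<close>

definition below :: "real \<Rightarrow> bool" where
  "below r \<longleftrightarrow> (\<exists>n>0. \<exists>a\<ge>0. a < 1 \<and> (\<forall>w. N (monom 1 n * w) \<le> a * r ^ n * N w))"

text \<open>For large n both N(X^n w) / N w and s^n are at most r^n / 8, so X^n - r^n is comparable
  to r^n. With x = N(X^n w), \<open>two_radii\<close> then gives 7/8 x <= 9/64 (x + s^n N w), and x
  can be absorbed on the left. The admissible step r - s depends on \<open>K\<close> and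
  \<open>c\<close> alone.\<close>

lemma below_step:
  assumes "below r" "0 < s" "s < r" "r \<le> K + 1" "K / c\<^sup>2 * (r - s) \<le> 1 / 8"
  shows "below s"
proof -
  obtain n0 a where n0: "n0 > 0" "a \<ge> 0" "a < 1" and a: "\<And>w. N (monom 1 n0 * w) \<le> a * r ^ n0 * N w"
    using assms(1) unfolding below_def by blast
  \<comment> \<open>A common power m brings both \<open>a\<close> and (s/r)^n0 below 1/8.\<close>
  have "(s / r) ^ n0 < 1" using assms n0 by (simp add: power_less_one_iff)
  with n0 assms have b: "max a ((s / r) ^ n0) < 1" "max a ((s / r) ^ n0) \<ge> 0" by auto
  obtain m where m: "max a ((s / r) ^ n0) ^ m < 1 / 8"
    using real_arch_pow_inv[of "1/8" "max a ((s / r) ^ n0)"] b by auto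
  have m0: "m > 0" using m by (cases m) auto
  define n where "n = n0 * m"
  have n: "n > 0" using n0 m0 by (simp add: n_def)
  have am: "a ^ m \<le> 1 / 8" "((s / r) ^ n0) ^ m \<le> 1 / 8"
    using m n0 assms b by (smt (verit) power_mono divide_nonneg_nonneg zero_le_power)+
  have sr: "s ^ n \<le> r ^ n / 8"
  proof -
    have "(s / r) ^ n \<le> 1 / 8" using am(2) by (simp add: n_def power_mult)
    then show ?thesis using assms by (simp add: power_divide divide_le_eq)
  qed
  have rn: "r ^ n > 0" using assms by simp
  have mon: "monom 1 n = (monom 1 n0 :: complex poly) ^ m"
    by (simp add: n_def monom_power)
  have Nr: "N (monom 1 n * w) \<le> r ^ n / 8 * N w" for w
  proof -
    have "N (monom 1 n * w) \<le> (a * r ^ n0) ^ m * N w"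
      unfolding mon using a n0 assms by (intro power_le) auto
    also have "(a * r ^ n0) ^ m = a ^ m * r ^ n"
      by (simp add: n_def power_mult power_mult_distrib)
    also have "a ^ m * r ^ n * N w \<le> 1 / 8 * r ^ n * N w"
      using am rn nonneg by (intro mult_right_mono) auto
    finally show ?thesis by simp
  qed
  have cst: "N ((monom 1 n - [:of_real t:]) * w) \<le> N (monom 1 n * w) + t * N w" if "t \<ge> 0" for t w
    using diff[of "monom 1 n * w" "smult (of_real t) w"] that by (simp add: smult algebra_simps)
  have "N (monom 1 n * w) \<le> 1 / 2 * s ^ n * N w" for w
  proof -
    let ?x = "N (monom 1 n * w)" and ?u = "(monom 1 n - [:of_real (s ^ n):]) * w"
    have "7 / 8 * r ^ n * ?x \<le> (r ^ n - s ^ n) * ?x"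
      using sr nonneg by (intro mult_right_mono) auto
    also have "\<dots> \<le> K / c\<^sup>2 * (r - s) * N ((monom 1 n - [:of_real (r ^ n):]) * ?u)"
      using two_radii[OF n assms(2) _ assms(4)] assms by auto
    also have "\<dots> \<le> 1 / 8 * N ((monom 1 n - [:of_real (r ^ n):]) * ?u)"
      using assms nonneg by (intro mult_right_mono) auto
    also have "\<dots> \<le> 1 / 8 * (r ^ n / 8 * N ?u + r ^ n * N ?u)"
      using cst[of "r ^ n" ?u] Nr[of ?u] rn by auto
    also have "\<dots> = 9 / 64 * r ^ n * N ?u" by simp
    also have "\<dots> \<le> 9 / 64 * r ^ n * (?x + s ^ n * N w)"
      using cst[of "s ^ n" w] rn assms by (intro mult_left_mono) auto
    finally have "r ^ n * (7 / 8 * ?x) \<le> r ^ n * (9 / 64 * (?x + s ^ n * N w))"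
      by (simp add: mult_ac)
    then have "7 / 8 * ?x \<le> 9 / 64 * (?x + s ^ n * N w)"
      using rn by simp
    moreover have "s ^ n * N w \<ge> 0" using assms nonneg by simp
    ultimately show ?thesis by simp
  qed
  then show ?thesis unfolding below_def using n by (intro exI[of _ n] conjI exI[of _ "1/2"]) auto
qed

text \<open>One multiplication by X suffices, as K < K + 1; the radius K itself would not give a
  factor less than 1.\<close>

lemma below_start: "below (K + 1)"
proof -
  have "N (monom 1 1 * w) \<le> K / (K + 1) * (K + 1) ^ 1 * N w" for w
    using shift[of w] pos by (simp add: monom_Suc)
  then show ?thesis
    unfolding below_def using pos by (intro exI[of _ 1] conjI exI[of _ "K / (K + 1)"]) auto
qed

lemma below_all:
  assumes "0 < s" "s < K + 1"
  shows "below s"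
proof -
  \<comment> \<open>With J > B equal steps from K + 1 down to s, each step meets the size condition
    of \<open>below_step\<close>.\<close>
  define B where "B = 8 * (K / c\<^sup>2) * (K + 1 - s)"
  obtain J :: nat where J: "max B 1 < real J"
    using reals_Archimedean2 by blast
  then have J0: "real J > 0" by simp
  define t where "t = (\<lambda>j::nat. K + 1 - real j * (K + 1 - s) / J)"
  have "below (t j)" if "j \<le> J" for j
    using that
  proof (induction j)
    case 0
    then show ?case using below_start by (simp add: t_def)
  next
    case (Suc j)
    have d: "t j - t (Suc j) = (K + 1 - s) / J"
      by (simp add: t_def distrib_right add_divide_distrib)
    have "real (Suc j) * (K + 1 - s) / J \<le> K + 1 - s"
      using Suc.prems J0 assms by (simp add: divide_le_eq mult.commute mult_left_mono)
    then have "t (Suc j) > 0" using assms by (simp add: t_def)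
    moreover have "t (Suc j) < t j" using d assms J0
      by (smt (verit) divide_pos_pos)
    moreover have "t j \<le> K + 1" using assms J0 by (simp add: t_def)
    moreover have "K / c\<^sup>2 * (t j - t (Suc j)) \<le> 1 / 8"
    proof -
      have "K / c\<^sup>2 * (t j - t (Suc j)) = B / (8 * J)"
        unfolding d by (simp add: B_def)
      also have "\<dots> \<le> 1 / 8" using J J0 by (simp add: divide_le_eq)
      finally show ?thesis .
    qed
    moreover have "below (t j)" using Suc by simp
    ultimately show ?case using below_step[of "t j" "t (Suc j)"] by blast
  qed
  from this[of J] J0 show ?thesis by (simp add: t_def)
qed

text \<open>Iterating \<open>lower\<close> at 0 makes N(X^n p) at least c^n N p, while
  \<open>below s\<close> with s <= c makes it less than that unless N p = 0.\<close>

theorem seminorm_trivial: "N p = 0"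
proof (rule ccontr)
  assume "N p \<noteq> 0"
  then have p: "N p > 0" using nonneg[of p] by simp
  define s where "s = min c (K + 1) / 2"
  have s: "0 < s" "s < K + 1" "s \<le> c" using pos by (auto simp: s_def)
  obtain n a where n: "n > 0" "a \<ge> 0" "a < 1" and a: "\<And>w. N (monom 1 n * w) \<le> a * s ^ n * N w"
    using below_all[OF s(1,2)] unfolding below_def by blast
  have "c ^ m * N p \<le> N (monom 1 m * p)" for m
  proof (induction m)
    case (Suc m)
    have "c ^ Suc m * N p \<le> c * N (monom 1 m * p)"
      using Suc pos by simp
    also have "\<dots> \<le> N ([:- 0, 1:] * (monom 1 m * p))"
      using pos by (intro lower) auto
    finally show ?case by (simp add: monom_Suc)
  qed simp
  from this[of n] a[of p] have "c ^ n * N p \<le> a * s ^ n * N p" by linarith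
  with p have "c ^ n \<le> a * s ^ n" by simp
  also have "\<dots> < s ^ n" using n s by simp
  also have "\<dots> \<le> c ^ n" using s by (simp add: power_mono)
  finally show False by simp
qed

end

section \<open>Norming functionals\<close>

text \<open>One inequality for a > 0 is what infima deliver directly; \<open>sublinear_scale\<close>
  recovers equality for a >= 0.\<close>

definition sublinear :: "('a::real_vector \<Rightarrow> real) \<Rightarrow> bool" where
  "sublinear q \<longleftrightarrow> (\<forall>x y. q (x + y) \<le> q x + q y) \<and> (\<forall>a>0. \<forall>x. q (a *\<^sub>R x) \<le> a * q x)"

lemma sublinear_scale:
  assumes "sublinear q" "a \<ge> 0"
  shows "q (a *\<^sub>R x) = a * q x"
proof -
  have le: "q (a *\<^sub>R x) \<le> a * q x" if "a > 0" for a x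
    using assms(1) that unfolding sublinear_def by blast
  show ?thesis
  proof (cases "a = 0")
    case True
    \<comment> \<open>q 0 <= q 0 / 2 and q 0 <= 2 q 0 force q 0 = 0.\<close>
    then show ?thesis using le[of "1/2" 0] le[of 2 0] by simp
  next
    case False
    then have a: "a > 0" using assms by simp
    then have "q x \<le> 1 / a * q (a *\<^sub>R x)"
      using le[of "1 / a" "a *\<^sub>R x"] by simp
    with a have "a * q x \<le> q (a *\<^sub>R x)" by (simp add: field_simps)
    with le[OF a] show ?thesis by (simp add: order_antisym)
  qed
qed

text \<open>The lower bound is independent of \<open>y\<close>; it keeps the infima in
  \<open>slide\<close> and along chains finite.\<close>

lemma sublinear_diff_le:
  assumes "sublinear q"
  shows "- q (- x) \<le> q (x + y) - q y"
proof -
  have "q y \<le> q (x + y) + q (- x)"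
  proof -
    have "q ((x + y) + - x) \<le> q (x + y) + q (- x)"
      using assms unfolding sublinear_def by blast
    then show ?thesis by simp
  qed
  then show ?thesis by simp
qed

lemma sublinear_minus_le: "sublinear q \<Longrightarrow> - q (- x) \<le> q x"
  using sublinear_diff_le[of q x 0] sublinear_scale[of q 0 0] by simp

text \<open>A minimal sublinear functional is linear: \<open>slide q y\<close> is again sublinear and below \<open>q\<close>, so minimality
  gives \<open>slide q y = q\<close>, and the term for \<open>t = 1\<close> is superadditivity in the direction of \<open>y\<close>. Starting Zorn's
  lemma below \<open>slide norm x0\<close> instead of \<open>norm\<close> makes the resulting functional norm \<open>x0\<close>.\<close>

definition slide :: "('a::real_vector \<Rightarrow> real) \<Rightarrow> 'a \<Rightarrow> 'a \<Rightarrow> real" where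
  "slide q y x = (INF t\<in>{0..}. q (x + t *\<^sub>R y) - t * q y)"

lemma slide_le:
  assumes "sublinear q" "t \<ge> 0"
  shows "slide q y x \<le> q (x + t *\<^sub>R y) - t * q y"
proof -
  have "- q (- x) \<le> q (x + t *\<^sub>R y) - t * q y" if "t \<ge> 0" for t
    using sublinear_diff_le[OF assms(1), of x "t *\<^sub>R y"] sublinear_scale[OF assms(1) that, of y] by simp
  then have "bdd_below ((\<lambda>t. q (x + t *\<^sub>R y) - t * q y) ` {0..})"
    by (intro bdd_belowI2) auto
  then show ?thesis unfolding slide_def using assms(2) by (intro cINF_lower) auto
qed

lemma slide_greatest:
  assumes "\<And>t. t \<ge> 0 \<Longrightarrow> b \<le> q (x + t *\<^sub>R y) - t * q y"
  shows "b \<le> slide q y x"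
  unfolding slide_def using assms by (intro cINF_greatest) auto

text \<open>The parameters form a cone: the terms for t and t' combine into the one for t + t', and
  scaling by a turns t into a t.\<close>

lemma sublinear_slide:
  assumes "sublinear q"
  shows "sublinear (slide q y)"
  unfolding sublinear_def
proof (intro conjI allI impI)
  fix x x'
  have "slide q y (x + x') - (q (x' + t' *\<^sub>R y) - t' * q y) \<le> q (x + t *\<^sub>R y) - t * q y"
    if "t \<ge> 0" "t' \<ge> 0" for t t'
  proof -
    have "slide q y (x + x') \<le> q ((x + t *\<^sub>R y) + (x' + t' *\<^sub>R y)) - (t + t') * q y"
      using slide_le[OF assms, of "t + t'" y "x + x'"] that by (simp add: algebra_simps)
    also have "q ((x + t *\<^sub>R y) + (x' + t' *\<^sub>R y)) \<le> q (x + t *\<^sub>R y) + q (x' + t' *\<^sub>R y)"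
      using assms unfolding sublinear_def by blast
    finally show ?thesis by (simp add: algebra_simps)
  qed
  then have "slide q y (x + x') - (q (x' + t' *\<^sub>R y) - t' * q y) \<le> slide q y x" if "t' \<ge> 0" for t'
    using that by (intro slide_greatest) auto
  then have "slide q y (x + x') - slide q y x \<le> slide q y x'"
    by (intro slide_greatest) (smt (verit))
  then show "slide q y (x + x') \<le> slide q y x + slide q y x'" by simp
next
  fix a :: real and x assume a: "a > 0"
  have "slide q y (a *\<^sub>R x) / a \<le> q (x + t *\<^sub>R y) - t * q y" if "t \<ge> 0" for t
  proof -
    have "slide q y (a *\<^sub>R x) \<le> q (a *\<^sub>R (x + t *\<^sub>R y)) - a * t * q y"
      using slide_le[OF assms, of "a * t" y "a *\<^sub>R x"] a that by (simp add: algebra_simps)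
    also have "\<dots> = a * (q (x + t *\<^sub>R y) - t * q y)"
      using a sublinear_scale[OF assms, of a "x + t *\<^sub>R y"] by (simp add: algebra_simps)
    finally show ?thesis using a by (simp add: divide_le_eq mult.commute)
  qed
  then have "slide q y (a *\<^sub>R x) / a \<le> slide q y x" by (rule slide_greatest)
  then show "slide q y (a *\<^sub>R x) \<le> a * slide q y x"
    using a by (simp add: divide_le_eq mult.commute)
qed

text \<open>Of two members of a chain the smaller one, m, gives m (x + y) <= m x + m y <= q x + q'
  y; then the infima over q and q' can be taken separately.\<close>

lemma sublinear_INF_chain:
  assumes "C \<noteq> {}" and C: "\<And>q. q \<in> C \<Longrightarrow> sublinear q \<and> q \<le> p"
    and chain: "\<And>q q'. q \<in> C \<Longrightarrow> q' \<in> C \<Longrightarrow> q \<le> q' \<or> q' \<le> q"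
  shows "sublinear (\<lambda>x. INF q\<in>C. q x)" "\<And>q x. q \<in> C \<Longrightarrow> (INF q\<in>C. q x) \<le> q x"
proof -
  have lower: "(INF q\<in>C. q x) \<le> q x" if "q \<in> C" for q x
  proof -
    have "- p (- x) \<le> q x" if "q \<in> C" for q
      using C[OF that] sublinear_minus_le[of q x] by (smt (verit) le_funD)
    then have "bdd_below ((\<lambda>q. q x) ` C)" by (intro bdd_belowI2)
    then show ?thesis using that by (intro cINF_lower)
  qed
  then show "\<And>q x. q \<in> C \<Longrightarrow> (INF q\<in>C. q x) \<le> q x" .
  show "sublinear (\<lambda>x. INF q\<in>C. q x)"
    unfolding sublinear_def
  proof (intro conjI allI impI)
    fix x y
    have "(INF q\<in>C. q (x + y)) \<le> q x + q' y" if qq: "q \<in> C" "q' \<in> C" for q q'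
    proof -
      obtain m where m: "m \<in> C" "m \<le> q" "m \<le> q'"
        using chain[OF qq] qq by blast
      have "(INF q\<in>C. q (x + y)) \<le> m (x + y)" using m by (intro lower)
      also have "\<dots> \<le> m x + m y" using C[OF m(1)] unfolding sublinear_def by blast
      also have "\<dots> \<le> q x + q' y" using m by (intro add_mono) (auto simp: le_fun_def)
      finally show ?thesis .
    qed
    then have "(INF q\<in>C. q (x + y)) - q' y \<le> (INF q\<in>C. q x)" if "q' \<in> C" for q'
      using that assms(1) by (intro cINF_greatest) (auto simp: diff_le_eq)
    then have "(INF q\<in>C. q (x + y)) - (INF q\<in>C. q x) \<le> (INF q\<in>C. q y)"
      using assms(1) by (intro cINF_greatest) (auto simp: diff_le_eq add.commute)
    then show "(INF q\<in>C. q (x + y)) \<le> (INF q\<in>C. q x) + (INF q\<in>C. q y)" by simp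
  next
    fix a :: real and x assume a: "a > 0"
    have "(INF q\<in>C. q (a *\<^sub>R x)) / a \<le> q x" if "q \<in> C" for q
      using lower[OF that, of "a *\<^sub>R x"] C[OF that] a
      by (simp add: sublinear_scale divide_le_eq mult.commute)
    then have "(INF q\<in>C. q (a *\<^sub>R x)) / a \<le> (INF q\<in>C. q x)"
      using assms(1) by (intro cINF_greatest) auto
    then show "(INF q\<in>C. q (a *\<^sub>R x)) \<le> a * (INF q\<in>C. q x)"
      using a by (simp add: divide_le_eq mult.commute)
  qed
qed

lemma linear_below_sublinear:
  assumes "sublinear p"
  obtains g where "linear g" "\<And>x. g x \<le> p x"
proof -
  define A where "A = {q. sublinear q \<and> q \<le> p}"
  \<comment> \<open>Zorn for the reversed order yields a minimal element.\<close>
  have "\<exists>m\<in>A. \<forall>a\<in>A. (\<lambda>q q'. q' \<le> q) m a \<longrightarrow> a = m"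
  proof (rule predicate_Zorn)
    show "partial_order_on A (relation_of (\<lambda>q q'. q' \<le> q) A)"
      by (rule partial_order_on_relation_ofI) auto
  next
    fix C assume "C \<in> Chains (relation_of (\<lambda>q q'. q' \<le> q) A)"
    then have CA: "C \<subseteq> A" and chain: "\<And>q q'. q \<in> C \<Longrightarrow> q' \<in> C \<Longrightarrow> q \<le> q' \<or> q' \<le> q"
      unfolding Chains_def relation_of_def by auto
    show "\<exists>u\<in>A. \<forall>a\<in>C. u \<le> a"
    proof (cases "C = {}")
      case True
      then show ?thesis using assms by (intro bexI[of _ p]) (auto simp: A_def)
    next
      case False
      then obtain q where q: "q \<in> C" by blast
      have *: "sublinear q \<and> q \<le> p" if "q \<in> C" for q
        using that CA by (auto simp: A_def)
      note inf = sublinear_INF_chain[OF False * chain, simplified]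
      have "(\<lambda>x. INF q\<in>C. q x) \<in> A"
        using inf(1) inf(2)[OF q] *[OF q] unfolding A_def by (auto simp: le_fun_def intro: order_trans)
      then show ?thesis using inf(2) by (intro bexI[of _ "\<lambda>x. INF q\<in>C. q x"]) (auto simp: le_fun_def)
    qed
  qed
  then obtain g where g: "sublinear g" "g \<le> p" and min: "\<And>q. sublinear q \<Longrightarrow> q \<le> g \<Longrightarrow> q = g"
    unfolding A_def by (auto intro: order_trans)
  have add: "g (x + y) = g x + g y" for x y
  proof -
    have "slide g y \<le> g"
      using slide_le[OF g(1), of 0 y] by (auto simp: le_fun_def)
    then have "slide g y = g" using min[OF sublinear_slide[OF g(1)]] by blast
    then have "g x \<le> g (x + y) - g y" using slide_le[OF g(1), of 1 y x] by simp
    moreover have "g (x + y) \<le> g x + g y" using g(1) unfolding sublinear_def by blast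
    ultimately show ?thesis by simp
  qed
  have zero: "g 0 = 0" using add[of 0 0] by simp
  have minus: "g (- x) = - g x" for x using add[of x "- x"] zero by simp
  have "g (a *\<^sub>R x) = a * g x" for a x
    using sublinear_scale[OF g(1), of a x] sublinear_scale[OF g(1), of "- a" x] minus[of "a *\<^sub>R x"]
    by (cases "a \<ge> 0") auto
  then have "linear g" using add by (intro linearI) auto
  with that g(2) show thesis by (auto simp: le_fun_def)
qed

text \<open>A real functional g is complexified as g x - i g(i x).\<close>

theorem norming_functional:
  fixes x0 :: "'a::complex_normed_vector"
  obtains f :: "'a \<Rightarrow> complex" where "\<And>x y. f (x + y) = f x + f y" "\<And>c x. f (c *\<^sub>C x) = c * f x"
    "\<And>x. cmod (f x) \<le> norm x" "cmod (f x0) = norm x0"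
proof -
  have n: "sublinear (norm :: 'a \<Rightarrow> real)"
    unfolding sublinear_def by (auto intro: norm_triangle_ineq)
  obtain g where g: "linear g" and le: "\<And>x. g x \<le> slide norm x0 x"
    using linear_below_sublinear[OF sublinear_slide[OF n]] by blast
  interpret g: linear g by fact
  have le_norm: "g x \<le> norm x" for x
    using le[of x] slide_le[OF n, of 0 x0 x] by simp
  \<comment> \<open>At - x0 the term of \<open>slide\<close> for t = 1 is norm 0 - norm x0.\<close>
  have "g (- x0) \<le> - norm x0"
    using le[of "- x0"] slide_le[OF n, of 1 x0 "- x0"] by simp
  then have g0: "norm x0 \<le> g x0" by (simp add: g.neg)
  define f where "f = (\<lambda>x. Complex (g x) (- g (\<i> *\<^sub>C x)))"
  have add: "f (x + y) = f x + f y" for x y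
    by (simp add: f_def g.add scaleC_add_right complex_eq_iff)
  have ii: "\<i> *\<^sub>C \<i> *\<^sub>C x = - x" for x :: 'a
    using scaleC_of_real[of "- 1" x] by (simp add: scaleC_scaleC)
  have I: "f (\<i> *\<^sub>C x) = \<i> * f x" for x
    by (simp add: f_def ii g.neg complex_eq_iff)
  have R: "f (complex_of_real a *\<^sub>C x) = complex_of_real a * f x" for a x
  proof -
    have "\<i> *\<^sub>C a *\<^sub>R x = a *\<^sub>R \<i> *\<^sub>C x"
      by (metis scaleC_of_real scaleC_scaleC mult.commute)
    then show ?thesis by (simp add: f_def scaleC_of_real g.scale complex_eq_iff)
  qed
  have scale: "f (c *\<^sub>C x) = c * f x" for c x
  proof -
    have "c *\<^sub>C x = complex_of_real (Re c) *\<^sub>C x + complex_of_real (Im c) *\<^sub>C \<i> *\<^sub>C x"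
      by (metis complex_eq mult.commute scaleC_add_left scaleC_scaleC)
    then have "f (c *\<^sub>C x) = (complex_of_real (Re c) + complex_of_real (Im c) * \<i>) * f x"
      by (simp only: add R I) (simp add: algebra_simps)
    also have "complex_of_real (Re c) + complex_of_real (Im c) * \<i> = c"
      by (simp add: complex_eq_iff)
    finally show ?thesis .
  qed
  have bound: "cmod (f x) \<le> norm x" for x
  proof (cases "f x = 0")
    case False
    \<comment> \<open>The rotation that makes f (u x) real and nonnegative, hence equal to its real
      part g (u x).\<close>
    define u where "u = cnj (f x) / cmod (f x)"
    have "f (u *\<^sub>C x) = of_real (cmod (f x))"
      using False by (simp add: scale u_def complex_norm_square[symmetric] power2_eq_square field_simps mult.commute)
    then have "cmod (f x) = g (u *\<^sub>C x)"
      by (simp add: f_def complex_eq_iff)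
    also have "\<dots> \<le> norm (u *\<^sub>C x)" by (rule le_norm)
    also have "\<dots> = norm x" using False by (simp add: norm_scaleC u_def norm_divide)
    finally show ?thesis .
  qed simp
  have "norm x0 \<le> Re (f x0)" using g0 by (simp add: f_def)
  then have "cmod (f x0) = norm x0"
    using complex_Re_le_cmod[of "f x0"] bound[of x0] by linarith
  with add scale bound that show thesis by blast
qed

section \<open>Subspaces of hereditarily indecomposable spaces\<close>

abbreviation "csubspace \<equiv> complex_vector.subspace"
abbreviation "cspan \<equiv> complex_vector.span"

lemma closed_inf_subspaceD:
  assumes "closed_inf_subspace V"
  shows "csubspace V" "closed V" "infinite_dimensional V"
  using assms unfolding closed_inf_subspace_def by auto

lemma bounded_linear_scaleC: "bounded_linear (\<lambda>x. c *\<^sub>C x)"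
proof (rule bounded_linear_intro)
  show "c *\<^sub>C r *\<^sub>R x = r *\<^sub>R c *\<^sub>C x" for r and x :: 'a
    by (metis scaleC_of_real scaleC_scaleC mult.commute)
  show "norm (c *\<^sub>C x) \<le> norm x * cmod c" for x :: 'a
    by (simp add: norm_scaleC mult.commute)
qed (rule scaleC_add_right)

lemmas tendsto_scaleC = bounded_linear.tendsto[OF bounded_linear_scaleC]

lemma csubspace_closure:
  assumes "csubspace S"
  shows "csubspace (closure S)"
proof (rule complex_vector.subspaceI)
  show "0 \<in> closure S"
    using complex_vector.subspace_0[OF assms] closure_subset by blast
next
  fix x y assume "x \<in> closure S" "y \<in> closure S"
  then obtain f g where "\<And>n. f n \<in> S" "f \<longlonglongrightarrow> x" "\<And>n. g n \<in> S" "g \<longlonglongrightarrow> y"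
    unfolding closure_sequential by blast
  then show "x + y \<in> closure S"
    unfolding closure_sequential using complex_vector.subspace_add[OF assms]
    by (intro exI[of _ "\<lambda>n. f n + g n"]) (auto intro: tendsto_add)
next
  fix c x assume "x \<in> closure S"
  then obtain f where "\<And>n. f n \<in> S" "f \<longlonglongrightarrow> x"
    unfolding closure_sequential by blast
  then show "c *\<^sub>C x \<in> closure S"
    unfolding closure_sequential using complex_vector.subspace_scale[OF assms]
    by (intro exI[of _ "\<lambda>n. c *\<^sub>C f n"]) (auto intro: tendsto_scaleC)
qed

lemma infinite_dimensionalI:
  assumes "\<And>n. \<exists>S. complex_vector.independent S \<and> S \<subseteq> V \<and> finite S \<and> card S = n"
  shows "infinite_dimensional V"
  unfolding infinite_dimensional_def
proof
  assume "\<exists>B. finite B \<and> cspan B = V"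
  then obtain B where B: "finite B" "cspan B = V" by blast
  obtain S where "complex_vector.independent S" "S \<subseteq> V" "card S = Suc (card B)"
    using assms by blast
  with complex_vector.independent_span_bound[OF B(1), of S] B show False by auto
qed

lemma infinite_dimensional_nonzero:
  assumes "csubspace V" "infinite_dimensional V"
  obtains v where "v \<in> V" "norm v = 1"
proof -
  have "V \<noteq> {0}"
    using assms(2) complex_vector.span_empty unfolding infinite_dimensional_def
    by (metis finite.emptyI)
  then obtain v where v: "v \<in> V" "v \<noteq> 0"
    using complex_vector.subspace_0[OF assms(1)] by blast
  show thesis
  proof
    show "complex_of_real (1 / norm v) *\<^sub>C v \<in> V"
      using v complex_vector.subspace_scale[OF assms(1)] by blast
    show "norm (complex_of_real (1 / norm v) *\<^sub>C v) = 1"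
      using v by (simp add: norm_scaleC norm_divide)
  qed
qed

text \<open>The kernel has codimension at most one: a single vector completes a spanning set of it
  to one of \<open>V\<close>.\<close>

lemma infinite_dimensional_kernel:
  assumes "csubspace V" "infinite_dimensional V"
    and "\<And>x y. f (x + y) = f x + f y" "\<And>c x. f (c *\<^sub>C x) = c * (f x :: complex)"
  shows "infinite_dimensional (V \<inter> {x. f x = 0})"
  unfolding infinite_dimensional_def
proof
  assume "\<exists>B. finite B \<and> cspan B = V \<inter> {x. f x = 0}"
  then obtain B where B: "finite B" "cspan B = V \<inter> {x. f x = 0}" by blast
  show False
  proof (cases "V \<subseteq> {x. f x = 0}")
    case True
    then have "cspan B = V" using B by blast
    then show False using B assms(2) unfolding infinite_dimensional_def by blast
  next
    case False
    then obtain a where a: "a \<in> V" "f a \<noteq> 0" by blast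
    have BV: "B \<subseteq> V" using B(2) complex_vector.span_superset by blast
    have "cspan (insert a B) = V"
    proof
      show "cspan (insert a B) \<subseteq> V"
        using a BV assms(1) by (intro complex_vector.span_minimal) auto
      show "V \<subseteq> cspan (insert a B)"
      proof
        fix x assume x: "x \<in> V"
        let ?k = "f x / f a"
        have "x = (x + (- ?k) *\<^sub>C a) + ?k *\<^sub>C a" by simp
        moreover have "f (x + (- ?k) *\<^sub>C a) = 0"
          using a by (simp only: assms(3,4)) simp
        moreover have "x + (- ?k) *\<^sub>C a \<in> V"
          using x a assms(1) by (intro complex_vector.subspace_add complex_vector.subspace_scale)
        ultimately have "x - ?k *\<^sub>C a \<in> cspan B"
          using B(2) by simp
        then show "x \<in> cspan (insert a B)"
          unfolding complex_vector.span_insert by blast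
      qed
    qed
    then show False using B(1) assms(2) unfolding infinite_dimensional_def by blast
  qed
qed

lemma closed_inf_subspace_kernel:
  assumes "closed_inf_subspace V"
    and f: "\<And>x y. f (x + y) = f x + f y" "\<And>c x. f (c *\<^sub>C x) = c * (f x :: complex)"
    and bound: "\<And>x. cmod (f x) \<le> norm x"
  shows "closed_inf_subspace (V \<inter> {x. f x = 0})"
  unfolding closed_inf_subspace_def
proof (intro conjI)
  note V = closed_inf_subspaceD[OF assms(1)]
  have "f 0 = 0" using f(2)[of 0 0] by simp
  then show "csubspace (V \<inter> {x. f x = 0})"
    using V(1) by (auto simp: complex_vector.subspace_def f)
  have "bounded_linear f"
  proof (rule bounded_linear_intro)
    show "f (r *\<^sub>R x) = r *\<^sub>R f x" for r x
      using f(2)[of "of_real r" x] by (simp add: scaleC_of_real scaleR_conv_of_real)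
    show "cmod (f x) \<le> norm x * 1" for x using bound by simp
  qed (rule f)
  then have "closed {x. f x = 0}"
    by (intro closed_Collect_eq) (auto intro: linear_continuous_on)
  then show "closed (V \<inter> {x. f x = 0})" using V(2) by (rule closed_Int[rotated])
  show "infinite_dimensional (V \<inter> {x. f x = 0})"
    using V f by (intro infinite_dimensional_kernel)
qed

section \<open>Operators on a subspace and the images of those bounded below\<close>

context
  fixes V :: "'a::complex_normed_vector set" and T :: "'a \<Rightarrow> 'b::complex_normed_vector"
  assumes V: "csubspace V" and T: "operator_on V T"
begin

lemma operator_on_add: "x \<in> V \<Longrightarrow> y \<in> V \<Longrightarrow> T (x + y) = T x + T y"
  using T unfolding operator_on_def by blast

lemma operator_on_scale: "x \<in> V \<Longrightarrow> T (c *\<^sub>C x) = c *\<^sub>C T x"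
  using T unfolding operator_on_def by blast

lemma operator_on_zero: "T 0 = 0"
  using operator_on_scale[of 0 0] complex_vector.subspace_0[OF V] by simp

lemma operator_on_diff: "x \<in> V \<Longrightarrow> y \<in> V \<Longrightarrow> T (x - y) = T x - T y"
  using operator_on_add[of x "- 1 *\<^sub>C y"] operator_on_scale[of y "- 1"]
    complex_vector.subspace_scale[OF V, of y "- 1"] by simp

lemma operator_on_sum:
  "(\<And>i. i \<in> I \<Longrightarrow> z i \<in> V) \<Longrightarrow> T (\<Sum>i\<in>I. a i *\<^sub>C z i) = (\<Sum>i\<in>I. a i *\<^sub>C T (z i))"
proof (induction I rule: infinite_finite_induct)
  case (insert j I)
  have "(\<Sum>i\<in>I. a i *\<^sub>C z i) \<in> V" "a j *\<^sub>C z j \<in> V"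
    using insert V by (auto intro!: complex_vector.subspace_sum complex_vector.subspace_scale)
  with insert show ?case by (simp add: operator_on_add operator_on_scale)
qed (auto simp: operator_on_zero)

lemma operator_on_bound:
  obtains K where "K > 0" "\<And>x. x \<in> V \<Longrightarrow> norm (T x) \<le> K * norm x"
proof -
  obtain K where K: "\<forall>x\<in>V. norm (T x) \<le> K * norm x"
    using T unfolding operator_on_def by blast
  have "norm (T x) \<le> max K 1 * norm x" if "x \<in> V" for x
    using K that mult_right_mono[of K "max K 1" "norm x"] by fastforce
  then show thesis using that[of "max K 1"] by simp
qed

lemma operator_on_subset: "W \<subseteq> V \<Longrightarrow> operator_on W T"
  using T unfolding operator_on_def by blast

end

lemma Cauchy_if_dist_le:
  fixes x :: "nat \<Rightarrow> 'a::real_normed_vector" and y :: "nat \<Rightarrow> 'b::real_normed_vector"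
  assumes "Cauchy y" "m > 0" "\<And>i j. m * norm (x i - x j) \<le> norm (y i - y j)"
  shows "Cauchy x"
  unfolding Cauchy_altdef
proof (intro allI impI)
  fix e :: real assume "e > 0"
  then obtain M where M: "\<And>i j. i \<ge> M \<Longrightarrow> j \<ge> M \<Longrightarrow> norm (y i - y j) < m * e"
    using assms(1,2) unfolding Cauchy_def dist_norm by (meson mult_pos_pos)
  have "dist (x i) (x j) < e" if "i \<ge> M" "j > i" for i j
  proof -
    have "m * norm (x i - x j) < m * e"
      using assms(3)[of i j] M[of i j] that by simp
    then show ?thesis using assms(2) by (simp add: dist_norm)
  qed
  then show "\<exists>M. \<forall>i\<ge>M. \<forall>j>i. dist (x i) (x j) < e" by blast
qed

text \<open>A convergent sequence of images lifts to a Cauchy sequence, and a finite spanning set of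
  the image pulls back by injectivity.\<close>

lemma closed_inf_subspace_image:
  fixes V :: "'a::complex_banach set" and T :: "'a \<Rightarrow> 'b::complex_normed_vector"
  assumes "closed_inf_subspace V" "operator_on V T"
    and "m > 0" and below: "\<And>x. x \<in> V \<Longrightarrow> m * norm x \<le> norm (T x)"
  shows "closed_inf_subspace (T ` V)"
  unfolding closed_inf_subspace_def
proof (intro conjI)
  note V = closed_inf_subspaceD[OF assms(1)]
  note op = operator_on_add[OF V(1) assms(2)] operator_on_scale[OF V(1) assms(2)]
    operator_on_zero[OF V(1) assms(2)] operator_on_diff[OF V(1) assms(2)]
  \<comment> \<open>Needed for \<open>V\<close> and, below, for the span of a finite set.\<close>
  have image: "csubspace (T ` W)" if "csubspace W" "W \<subseteq> V" for W
  proof (rule complex_vector.subspaceI)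
    show "0 \<in> T ` W" using op(3) complex_vector.subspace_0[OF that(1)] by (metis image_eqI)
    show "x + y \<in> T ` W" if xy: "x \<in> T ` W" "y \<in> T ` W" for x y
    proof -
      obtain u v where uv: "u \<in> W" "v \<in> W" "x = T u" "y = T v" using xy by blast
      then have "x + y = T (u + v)" using op(1)[of u v] \<open>W \<subseteq> V\<close> by (metis subsetD)
      then show ?thesis using uv complex_vector.subspace_add[OF \<open>csubspace W\<close>] by blast
    qed
    show "c *\<^sub>C x \<in> T ` W" if x: "x \<in> T ` W" for x c
    proof -
      obtain u where u: "u \<in> W" "x = T u" using x by blast
      then have "c *\<^sub>C x = T (c *\<^sub>C u)" using op(2)[of u c] \<open>W \<subseteq> V\<close> by (metis subsetD)
      then show ?thesis using u complex_vector.subspace_scale[OF \<open>csubspace W\<close>] by blast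
    qed
  qed
  show "csubspace (T ` V)" using image V by blast
  show "closed (T ` V)"
    unfolding closed_sequential_limits
  proof (intro allI impI)
    fix y l assume y: "(\<forall>n. y n \<in> T ` V) \<and> y \<longlonglongrightarrow> l"
    then have l: "y \<longlonglongrightarrow> l" by blast
    from y have "\<forall>n. \<exists>x. x \<in> V \<and> y n = T x" by blast
    then obtain x where x: "\<And>n. x n \<in> V" "\<And>n. y n = T (x n)" by metis
    have "m * norm (x i - x j) \<le> norm (y i - y j)" for i j
      using below[of "x i - x j"] op(4)[of "x i" "x j"] x complex_vector.subspace_diff[OF V(1)] by simp
    then have "Cauchy x" by (rule Cauchy_if_dist_le[OF LIMSEQ_imp_Cauchy[OF l] assms(3)])
    then obtain u where u: "x \<longlonglongrightarrow> u" by (auto simp: convergent_eq_Cauchy[symmetric] convergent_def)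
    have uV: "u \<in> V" using V(2) x(1) u by (rule closed_sequentially)
    obtain K where K: "K > 0" "\<And>x. x \<in> V \<Longrightarrow> norm (T x) \<le> K * norm x"
      using operator_on_bound[OF V(1) assms(2)] by blast
    have "norm (y n - T u) \<le> K * norm (x n - u)" for n
      using K(2)[of "x n - u"] op(4)[OF x(1) uV, of n] x uV complex_vector.subspace_diff[OF V(1)] by simp
    moreover have "(\<lambda>n. K * norm (x n - u)) \<longlonglongrightarrow> 0"
      using u by (intro tendsto_mult_right_zero tendsto_norm_zero) (simp add: LIM_zero_iff)
    ultimately have "(\<lambda>n. y n - T u) \<longlonglongrightarrow> 0"
      by (intro Lim_null_comparison[of "\<lambda>n. y n - T u" "\<lambda>n. K * norm (x n - u)"]) auto
    then have "y \<longlonglongrightarrow> T u" by (simp add: LIM_zero_iff)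
    then show "l \<in> T ` V" using LIMSEQ_unique[OF l] uV by blast
  qed
  show "infinite_dimensional (T ` V)"
    unfolding infinite_dimensional_def
  proof
    assume "\<exists>B. finite B \<and> cspan B = T ` V"
    then obtain B where B: "finite B" "cspan B = T ` V" by blast
    have "B \<subseteq> T ` V" using B(2) complex_vector.span_superset by blast
    then obtain C where C: "C \<subseteq> V" "finite C" "B = T ` C"
      using B(1) finite_subset_image by metis
    have CV: "cspan C \<subseteq> V" using C V by (intro complex_vector.span_minimal)
    have "T ` V \<subseteq> T ` cspan C"
      unfolding B(2)[symmetric] C(3)
      by (intro complex_vector.span_minimal image_mono complex_vector.span_superset
          image complex_vector.subspace_span CV)
    have "V \<subseteq> cspan C"
    proof
      fix x assume x: "x \<in> V"
      then obtain y where y: "y \<in> cspan C" "T x = T y"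
        using \<open>T ` V \<subseteq> T ` cspan C\<close> by blast
      then have "m * norm (x - y) \<le> 0"
        using below[of "x - y"] op(4)[of x y] x CV complex_vector.subspace_diff[OF V(1)] by auto
      then have "x = y" using assms(3) by (simp add: mult_le_0_iff)
      then show "x \<in> cspan C" using y by simp
    qed
    then show False
      using V(3) C(2) CV unfolding infinite_dimensional_def by blast
  qed
qed

text \<open>If the unit sphere of \<open>C\<close> kept distance \<delta> from \<open>D\<close>, the
  projection of C + D onto \<open>C\<close> would be bounded, and the sum would be direct and
  closed.\<close>

lemma close_unit_vectors:
  fixes C D :: "'a::complex_banach set"
  assumes HI: "hereditarily_indecomposable (UNIV :: 'a set)"
    and "closed_inf_subspace C" "closed_inf_subspace D" "\<delta> > 0"
  obtains c d where "c \<in> C" "d \<in> D" "norm c = 1" "norm (c - d) < \<delta>"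
proof (cases "\<exists>c\<in>C. \<exists>d\<in>D. norm c = 1 \<and> norm (c - d) < \<delta>")
  case True
  then show thesis using that by blast
next
  case False
  note C = closed_inf_subspaceD[OF assms(2)] and D = closed_inf_subspaceD[OF assms(3)]
  have far: "\<delta> * norm c \<le> norm (c - d)" if "c \<in> C" "d \<in> D" for c d
  proof (cases "c = 0")
    case False
    let ?r = "complex_of_real (1 / norm c)"
    have "?r *\<^sub>C c \<in> C" "?r *\<^sub>C d \<in> D"
      using that complex_vector.subspace_scale[OF C(1)] complex_vector.subspace_scale[OF D(1)] by blast+
    moreover have "norm (?r *\<^sub>C c) = 1" using False by (simp add: norm_scaleC norm_divide)
    ultimately have "\<not> norm (?r *\<^sub>C c - ?r *\<^sub>C d) < \<delta>"
      using \<open>\<not> (\<exists>c\<in>C. \<exists>d\<in>D. norm c = 1 \<and> norm (c - d) < \<delta>)\<close> by blast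
    moreover have "norm (?r *\<^sub>C c - ?r *\<^sub>C d) = norm (c - d) / norm c"
      using False by (simp add: norm_scaleC norm_divide flip: complex_vector.scale_right_diff_distrib)
    ultimately have "\<delta> \<le> norm (c - d) / norm c" by linarith
    then show ?thesis using False by (simp add: pos_le_divide_eq)
  qed simp
  have "C \<inter> D = {0}"
  proof -
    have "x = 0" if "x \<in> C" "x \<in> D" for x
      using far[OF that] assms(4) by (simp add: mult_le_0_iff)
    then show ?thesis
      using complex_vector.subspace_0[OF C(1)] complex_vector.subspace_0[OF D(1)] by blast
  qed
  moreover have "closed {y + z | y z. y \<in> C \<and> z \<in> D}"
    unfolding closed_sequential_limits
  proof (intro allI impI)
    fix s l assume s: "(\<forall>n. s n \<in> {y + z | y z. y \<in> C \<and> z \<in> D}) \<and> s \<longlonglongrightarrow> l"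
    then have l: "s \<longlonglongrightarrow> l" by blast
    from s have "\<forall>n. \<exists>y z. y \<in> C \<and> z \<in> D \<and> s n = y + z" by blast
    then obtain y z where yz: "\<And>n. y n \<in> C" "\<And>n. z n \<in> D" "\<And>n. s n = y n + z n" by metis
    have "\<delta> * norm (y i - y j) \<le> norm (s i - s j)" for i j
      using far[of "y i - y j" "z j - z i"] yz complex_vector.subspace_diff[OF C(1)]
        complex_vector.subspace_diff[OF D(1)] by (simp add: algebra_simps)
    then have "Cauchy y" by (rule Cauchy_if_dist_le[OF LIMSEQ_imp_Cauchy[OF l] assms(4)])
    then obtain u where u: "y \<longlonglongrightarrow> u" by (auto simp: convergent_eq_Cauchy[symmetric] convergent_def)
    have "(\<lambda>n. s n - y n) \<longlonglongrightarrow> l - u" using l u by (rule tendsto_diff)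
    then have "z \<longlonglongrightarrow> l - u" by (simp add: yz(3))
    with D(2) yz(2) have "l - u \<in> D" by (rule closed_sequentially)
    moreover have "u \<in> C" using C(2) yz(1) u by (rule closed_sequentially)
    moreover have "l = u + (l - u)" by simp
    ultimately show "l \<in> {y + z | y z. y \<in> C \<and> z \<in> D}" by blast
  qed
  ultimately show thesis
    using HI assms(2,3) unfolding hereditarily_indecomposable_def by blast
qed

text \<open>A substitute for a basic sequence: \<open>f n\<close> norms \<open>z n\<close> and kills
  all later vectors, but may act on earlier ones. Such a sequence can be chosen greedily inside
  kernels.\<close>

locale triangular_sequence =
  fixes z :: "nat \<Rightarrow> 'a::complex_normed_vector" and f :: "nat \<Rightarrow> 'a \<Rightarrow> complex"
  assumes unit: "norm (z n) = 1"
    and functional_add: "f n (x + y) = f n x + f n y"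
    and functional_scale: "f n (c *\<^sub>C x) = c * f n x"
    and functional_bound: "cmod (f n x) \<le> norm x"
    and diagonal: "cmod (f n (z n)) = 1"
    and triangular: "n < m \<Longrightarrow> f n (z m) = 0"
begin

lemma functional_sum: "f n (\<Sum>i\<in>I. a i *\<^sub>C x i) = (\<Sum>i\<in>I. a i * f n (x i))"
proof (induction I rule: infinite_finite_induct)
  case (insert i I)
  then show ?case by (simp add: functional_add functional_scale)
qed (use functional_scale[of n 0 0] in auto)

text \<open>The bound does not depend on the number of terms, so small values of an operator at the \<open>z k\<close>
  make it small on the whole span.\<close>

lemma coefficient_bound:
  assumes w: "w = (\<Sum>k<n. a k *\<^sub>C z k)"
  shows "k < n \<Longrightarrow> cmod (a k) \<le> 2 ^ k * norm w"
proof (induction k rule: less_induct)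
  case (less k)
  \<comment> \<open>\<open>f k\<close> removes the terms after k, so \<open>a k\<close> is
    controlled by \<open>w\<close> and the earlier coefficients.\<close>
  have "{..<n} = insert k ({..<k} \<union> {k<..<n})" using less.prems by auto
  moreover have "(\<Sum>i\<in>{..<k} \<union> {k<..<n}. a i * f k (z i))
      = (\<Sum>i<k. a i * f k (z i)) + (\<Sum>i\<in>{k<..<n}. a i * f k (z i))"
    by (rule sum.union_disjoint) auto
  ultimately have "f k w = a k * f k (z k) + (\<Sum>i<k. a i * f k (z i)) + (\<Sum>i\<in>{k<..<n}. a i * f k (z i))"
    unfolding w functional_sum by simp
  also have "(\<Sum>i\<in>{k<..<n}. a i * f k (z i)) = 0"
    by (intro sum.neutral) (auto simp: triangular)
  finally have "a k * f k (z k) = f k w - (\<Sum>i<k. a i * f k (z i))" by simp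
  then have "cmod (a k) = cmod (f k w - (\<Sum>i<k. a i * f k (z i)))"
    by (metis diagonal norm_mult mult.right_neutral)
  also have "\<dots> \<le> norm w + (\<Sum>i<k. 2 ^ i * norm w)"
  proof (rule order_trans[OF norm_triangle_ineq4], rule add_mono[OF functional_bound], rule sum_norm_le)
    fix i assume i: "i \<in> {..<k}"
    have "cmod (f k (z i)) \<le> 1" using functional_bound[of k "z i"] unit by simp
    then have "cmod (a i * f k (z i)) \<le> cmod (a i)"
      by (simp add: norm_mult mult_left_le)
    also have "\<dots> \<le> 2 ^ i * norm w" using less i by simp
    finally show "cmod (a i * f k (z i)) \<le> 2 ^ i * norm w" .
  qed
  also have "\<dots> = (1 + (\<Sum>i<k. 2 ^ i)) * norm w"
    by (simp add: sum_distrib_right distrib_right)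
  \<comment> \<open>The bounds 2^i are those that reproduce themselves in this recursion.\<close>
  also have "1 + (\<Sum>i<k. 2 ^ i) = (2 ^ k :: real)"
    by (induction k) auto
  finally show ?case .
qed

lemma span_rangeE:
  assumes "w \<in> cspan (range z)"
  obtains n a where "w = (\<Sum>k<n. a k *\<^sub>C z k)"
proof -
  have "\<exists>n a. w = (\<Sum>k<n. a k *\<^sub>C z k)"
    using assms
  proof (induction rule: complex_vector.span_induct_alt)
    case base
    show ?case by (intro exI[of _ 0]) auto
  next
    case (step c x w)
    then obtain n a j where w: "w = (\<Sum>k<n. a k *\<^sub>C z k)" and x: "x = z j" by blast
    define N where "N = max n (Suc j)"
    have "w = (\<Sum>k<N. (if k < n then a k else 0) *\<^sub>C z k)"
      unfolding w by (intro sum.mono_neutral_cong_left) (auto simp: N_def)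
    moreover have "c *\<^sub>C x = (\<Sum>k<N. (if k = j then c else 0) *\<^sub>C z k)"
      unfolding x by (subst sum.remove[of _ j]) (auto simp: N_def)
    ultimately have "c *\<^sub>C x + w
        = (\<Sum>k<N. ((if k = j then c else 0) + (if k < n then a k else 0)) *\<^sub>C z k)"
      by (simp add: sum.distrib scaleC_add_left)
    then show ?case
      by (intro exI[of _ N] exI[of _ "\<lambda>k. (if k = j then c else 0) + (if k < n then a k else 0)"])
  qed
  then show thesis using that by blast
qed

text \<open>Independence is built backwards from the last vector: \<open>f k\<close> vanishes on the
  span of the later vectors but not at \<open>z k\<close>.\<close>

lemma infinite_dimensional:
  assumes "range z \<subseteq> V"
  shows "infinite_dimensional V"
proof (rule infinite_dimensionalI)
  fix n
  have "complex_vector.independent (z ` {k..<n}) \<and> card (z ` {k..<n}) = n - k" if "k \<le> n" for k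
    using that
  proof (induction rule: inc_induct)
    case base
    show ?case by (simp add: complex_vector.independent_empty)
  next
    case (step k)
    have kernel: "csubspace {x. f k x = 0}"
      using functional_scale[of k 0 0] by (intro complex_vector.subspaceI) (auto simp: functional_add functional_scale)
    have "cspan (z ` {Suc k..<n}) \<subseteq> {x. f k x = 0}"
      using kernel by (intro complex_vector.span_minimal) (auto simp: triangular)
    then have notin: "z k \<notin> cspan (z ` {Suc k..<n})"
      using diagonal[of k] by auto
    then have "z k \<notin> z ` {Suc k..<n}"
      by (rule contra_subsetD[OF complex_vector.span_superset])
    moreover have "{k..<n} = insert k {Suc k..<n}" using step by auto
    ultimately show ?case
      using notin step by (simp add: complex_vector.independent_insert)
  qed
  from this[of 0] show "\<exists>S. complex_vector.independent S \<and> S \<subseteq> V \<and> finite S \<and> card S = n"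
    using assms by (intro exI[of _ "z ` {0..<n}"]) auto
qed

end

text \<open>Intersecting with the kernel of one functional keeps a closed infinite-dimensional
  subspace, so \<open>step\<close> applies at every stage.\<close>

lemma triangular_sequence_exists:
  assumes "closed_inf_subspace A"
    and step: "\<And>G n. closed_inf_subspace G \<Longrightarrow> G \<subseteq> A \<Longrightarrow> \<exists>z\<in>G. norm z = 1 \<and> R n z"
  obtains z f where "triangular_sequence z f" "\<And>n. z n \<in> A" "\<And>n. R n (z n)"
proof -
  \<comment> \<open>\<open>G\<close> is the intersection of \<open>A\<close> with the kernels of all earlier functionals.\<close>
  define P where "P = (\<lambda>n (G, z, f). closed_inf_subspace G \<and> G \<subseteq> A \<and> z \<in> G \<and> norm z = 1 \<and> R n z
    \<and> (\<forall>x y. f (x + y) = f x + f y) \<and> (\<forall>c x. f (c *\<^sub>C x) = c * f x) \<and> (\<forall>x. cmod (f x) \<le> norm x)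
    \<and> cmod (f z) = 1)"
  define Q where "Q = (\<lambda>(n::nat) (G, z::'a, f::'a \<Rightarrow> complex) (G', z'::'a, f'::'a \<Rightarrow> complex). G' = G \<inter> {x. f x = (0::complex)})"
  have ex: "\<exists>z f. P n (G, z, f)" if G: "closed_inf_subspace G" "G \<subseteq> A" for G n
  proof -
    obtain z where z: "z \<in> G" "norm z = 1" "R n z" using step[OF G] by blast
    obtain f where "\<And>x y. f (x + y) = f x + f y" "\<And>c x. f (c *\<^sub>C x) = c * f x"
      "\<And>x. cmod (f x) \<le> norm x" "cmod (f z) = norm z"
      using norming_functional[of z] by blast
    with z G show ?thesis unfolding P_def by auto
  qed
  have "\<exists>s. \<forall>n. P n (s n) \<and> Q n (s n) (s (Suc n))"
  proof (rule dependent_nat_choice)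
    show "\<exists>x. P 0 x" using ex[OF assms(1)] by blast
  next
    fix s n assume s: "P n s"
    obtain G z f where sG: "s = (G, z, f)" by (cases s)
    have "closed_inf_subspace (G \<inter> {x. f x = 0})" "G \<inter> {x. f x = 0} \<subseteq> A"
      using s unfolding sG P_def by (auto intro!: closed_inf_subspace_kernel)
    from ex[OF this] obtain z' f' where "P (Suc n) (G \<inter> {x. f x = 0}, z', f')" by blast
    then show "\<exists>y. P (Suc n) y \<and> Q n s y" unfolding sG Q_def by blast
  qed
  then obtain s where s: "\<And>n. P n (s n)" "\<And>n. Q n (s n) (s (Suc n))" by blast
  define G z f where "G n = fst (s n)" "z n = fst (snd (s n))" "f n = snd (snd (s n))" for n
  have PG: "P n (G n, z n, f n)" for n using s(1)[of n] by (simp add: G_z_f_def)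
  have GS: "G (Suc n) = G n \<inter> {x. f n x = 0}" for n
    using s(2)[of n] by (auto simp: G_z_f_def Q_def split_beta)
  have anti: "G m \<subseteq> G n" if "n \<le> m" for n m
    using lift_Suc_antimono_le[of G n m] that GS by blast
  show thesis
  proof
    show "triangular_sequence z f"
    proof
      show "f n (z m) = 0" if "n < m" for n m
      proof -
        have "z m \<in> G m" using PG[of m] unfolding P_def by simp
        then have "z m \<in> G (Suc n)" using anti[of "Suc n" m] that by auto
        then show ?thesis using GS by blast
      qed
    qed (use PG in \<open>auto simp: P_def\<close>)
    show "z n \<in> A" "R n (z n)" for n using PG[of n] unfolding P_def by auto
  qed
qed

lemma close_to_subspace:
  fixes A B :: "'a::complex_banach set" and T :: "'a \<Rightarrow> 'a"
  assumes HI: "hereditarily_indecomposable (UNIV :: 'a set)"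
    and A: "closed_inf_subspace A" and B: "closed_inf_subspace B" and T: "operator_on A T"
    and m: "m > 0" "\<And>x. x \<in> A \<Longrightarrow> m * norm x \<le> norm (T x)" and "\<epsilon> > 0"
  obtains A' where "A' \<subseteq> A" "closed_inf_subspace A'" "\<And>x. x \<in> A' \<Longrightarrow> \<exists>b\<in>B. norm (T x - b) \<le> \<epsilon> * norm x"
proof -
  note sub = closed_inf_subspaceD(1)[OF A]
  obtain K where K: "K > 0" "\<And>x. x \<in> A \<Longrightarrow> norm (T x) \<le> K * norm x"
    using operator_on_bound[OF sub T] by blast
  \<comment> \<open>Against coefficients of size 2^n these errors add up to at most \<epsilon> / 2;
    the other half is spent on passing to the closure.\<close>
  define R where "R = (\<lambda>n z. \<exists>b\<in>B. norm (T z - b) \<le> \<epsilon> / (4 * 4 ^ n))"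
  have step: "\<exists>z\<in>G. norm z = 1 \<and> R n z" if G: "closed_inf_subspace G" "G \<subseteq> A" for G n
  proof -
    define \<eta> where "\<eta> = \<epsilon> / (4 * 4 ^ n)"
    have \<eta>: "\<eta> > 0" using assms(7) by (simp add: \<eta>_def)
    note Gs = closed_inf_subspaceD(1)[OF G(1)]
    have TG: "operator_on G T" by (rule operator_on_subset[OF sub T G(2)])
    have "closed_inf_subspace (T ` G)"
      using m G by (intro closed_inf_subspace_image[OF G(1) TG, of m]) auto
    \<comment> \<open>A preimage of a unit vector has norm at least 1 / K, so normalising it
      multiplies the error by at most K.\<close>
    then obtain c d where cd: "c \<in> T ` G" "d \<in> B" "norm c = 1" "norm (c - d) < \<eta> / K"
      using close_unit_vectors[OF HI _ B, of "T ` G" "\<eta> / K"] \<eta> K by auto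
    then obtain y where y: "y \<in> G" "c = T y" by blast
    have n1: "1 \<le> K * norm y" using cd(3) K(2)[of y] y G by auto
    then have y0: "norm y > 0" by (smt (verit) K(1) mult_nonneg_nonpos norm_ge_zero)
    let ?r = "complex_of_real (1 / norm y)"
    have "norm (T (?r *\<^sub>C y) - ?r *\<^sub>C d) = norm (c - d) / norm y"
      using y y0 by (simp add: operator_on_scale[OF Gs TG] norm_scaleC norm_divide
          flip: complex_vector.scale_right_diff_distrib)
    also have "\<dots> \<le> norm (c - d) * K"
      using y0 n1 by (simp add: divide_le_eq mult.assoc mult_le_cancel_left1)
    also have "\<dots> \<le> \<eta>" using cd(4) K(1) by (simp add: field_simps)
    finally have "R n (?r *\<^sub>C y)"
      unfolding R_def \<eta>_def using complex_vector.subspace_scale[OF closed_inf_subspaceD(1)[OF B] cd(2)] by blast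
    moreover have "norm (?r *\<^sub>C y) = 1" using y0 by (simp add: norm_scaleC norm_divide)
    ultimately show ?thesis using complex_vector.subspace_scale[OF Gs y(1)] by blast
  qed
  have "\<exists>z f. triangular_sequence z f \<and> (\<forall>n. z n \<in> A) \<and> (\<forall>n. R n (z n))"
    by (rule triangular_sequence_exists[OF A, of R, OF step]) blast+
  then obtain z f where "triangular_sequence z f" and zA: "\<And>n. z n \<in> A" and R: "\<And>n. R n (z n)"
    by blast
  interpret triangular_sequence z f by fact
  obtain b where b: "\<And>n. b n \<in> B" "\<And>n. norm (T (z n) - b n) \<le> \<epsilon> / (4 * 4 ^ n)"
    using R unfolding R_def by metis
  have near: "\<exists>b\<in>B. norm (T w - b) \<le> \<epsilon> / 2 * norm w" if ws: "w \<in> cspan (range z)" for w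
  proof -
    obtain n a where w: "w = (\<Sum>k<n. a k *\<^sub>C z k)" using span_rangeE[OF ws] by blast
    let ?b = "\<Sum>k<n. a k *\<^sub>C b k"
    have "T w - ?b = (\<Sum>k<n. a k *\<^sub>C (T (z k) - b k))"
      unfolding w using zA by (simp add: operator_on_sum[OF sub T] sum_subtractf complex_vector.scale_right_diff_distrib)
    then have "norm (T w - ?b) \<le> (\<Sum>k<n. norm (a k *\<^sub>C (T (z k) - b k)))"
      by (simp add: norm_sum)
    also have "\<dots> \<le> (\<Sum>k<n. \<epsilon> / 4 * norm w * (1 / 2) ^ k)"
    proof (rule sum_mono)
      fix k assume "k \<in> {..<n}"
      then have "norm (a k *\<^sub>C (T (z k) - b k)) \<le> (2 ^ k * norm w) * (\<epsilon> / (4 * 4 ^ k))"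
        unfolding norm_scaleC using b(2)[of k] coefficient_bound[OF w, of k] by (intro mult_mono) auto
      also have "\<dots> = \<epsilon> / 4 * norm w * (1 / 2) ^ k"
        by (simp add: power_divide field_simps flip: power_mult_distrib)
      finally show "norm (a k *\<^sub>C (T (z k) - b k)) \<le> \<epsilon> / 4 * norm w * (1 / 2) ^ k" .
    qed
    also have "\<dots> = \<epsilon> / 4 * norm w * (\<Sum>k<n. (1 / 2) ^ k)" by (simp add: sum_distrib_left)
    also have "\<dots> \<le> \<epsilon> / 4 * norm w * 2"
      using assms(7) by (intro mult_left_mono) (auto simp: sum_gp_strict)
    finally show ?thesis
      using b(1) closed_inf_subspaceD(1)[OF B]
      by (intro bexI[of _ ?b]) (auto intro!: complex_vector.subspace_sum complex_vector.subspace_scale)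
  qed
  define A' where "A' = closure (cspan (range z))"
  have span: "cspan (range z) \<subseteq> A" using zA sub by (intro complex_vector.span_minimal) auto
  then have A'A: "A' \<subseteq> A"
    unfolding A'_def using closed_inf_subspaceD(2)[OF A] by (rule closure_minimal)
  have "range z \<subseteq> A'"
    unfolding A'_def by (rule order_trans[OF complex_vector.span_superset closure_subset])
  then have "closed_inf_subspace A'"
    unfolding closed_inf_subspace_def
    using infinite_dimensional csubspace_closure[OF complex_vector.subspace_span]
    by (simp add: A'_def)
  moreover have "\<exists>b\<in>B. norm (T w - b) \<le> \<epsilon> * norm w" if w: "w \<in> A'" for w
  proof (cases "w = 0")
    case True
    then show ?thesis
      using complex_vector.subspace_0[OF closed_inf_subspaceD(1)[OF B]]
      by (intro bexI[of _ 0]) (auto simp: operator_on_zero[OF sub T])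
  next
    case False
    \<comment> \<open>Chosen so that (K + \<epsilon>) \<delta> is the remaining half of the
      error.\<close>
    define \<delta> where "\<delta> = \<epsilon> / 2 * norm w / (K + \<epsilon>)"
    have "\<delta> > 0" using False assms(7) K(1) by (simp add: \<delta>_def)
    then obtain w' where w': "w' \<in> cspan (range z)" "norm (w - w') < \<delta>"
      using w unfolding A'_def closure_approachable by (metis dist_commute dist_norm)
    obtain b where b: "b \<in> B" "norm (T w' - b) \<le> \<epsilon> / 2 * norm w'" using near[OF w'(1)] by blast
    have in_A: "w \<in> A" "w' \<in> A" using w A'A w'(1) span by auto
    have "norm (T w - T w') \<le> K * norm (w - w')"
      using K(2)[of "w - w'"] in_A complex_vector.subspace_diff[OF sub] by (simp add: operator_on_diff[OF sub T])
    also have "\<dots> \<le> K * \<delta>" using w'(2) K(1) by simp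
    finally have 1: "norm (T w - T w') \<le> K * \<delta>" .
    have "norm w' \<le> norm w + \<delta>" using w'(2) norm_triangle_ineq2[of w' w] by (simp add: norm_minus_commute)
    then have "\<epsilon> / 2 * norm w' \<le> \<epsilon> / 2 * (norm w + \<delta>)" using assms(7) by simp
    then have "norm (T w - b) \<le> K * \<delta> + \<epsilon> / 2 * (norm w + \<delta>)"
      using 1 b(2) norm_triangle_ineq[of "T w - T w'" "T w' - b"] by simp
    also have "\<dots> \<le> (K + \<epsilon>) * \<delta> + \<epsilon> / 2 * norm w"
      using assms(7) \<open>\<delta> > 0\<close> by (simp add: algebra_simps)
    also have "(K + \<epsilon>) * \<delta> = \<epsilon> / 2 * norm w"
    proof -
      have "K + \<epsilon> \<noteq> 0" using assms(7) K(1) by simp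
      then show ?thesis
        unfolding \<delta>_def times_divide_eq_right by (rule nonzero_mult_div_cancel_left)
    qed
    finally show ?thesis using b(1) by auto
  qed
  ultimately show thesis using that A'A by blast
qed

section \<open>Approximate orbits\<close>

text \<open>\<open>close_to_subspace\<close> for the identity, once per subspace; shrinking
  preserves the nearness already gained.\<close>

lemma close_to_finitely_many:
  fixes A :: "'a::complex_banach set"
  assumes HI: "hereditarily_indecomposable (UNIV :: 'a set)" and "finite Zs"
    and "\<And>Z. Z \<in> Zs \<Longrightarrow> closed_inf_subspace Z"
    and A: "closed_inf_subspace A" and \<epsilon>: "\<epsilon> > 0"
  shows "\<exists>W\<subseteq>A. closed_inf_subspace W \<and> (\<forall>x\<in>W. \<forall>Z\<in>Zs. \<exists>z\<in>Z. norm (x - z) \<le> \<epsilon> * norm x)"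
  using assms(2,3)
proof (induction Zs rule: finite_induct)
  case empty
  show ?case using A by (intro exI[of _ A]) auto
next
  case (insert Z Zs)
  then obtain W where W: "W \<subseteq> A" "closed_inf_subspace W"
    "\<And>x Z. x \<in> W \<Longrightarrow> Z \<in> Zs \<Longrightarrow> \<exists>z\<in>Z. norm (x - z) \<le> \<epsilon> * norm x"
    by (auto simp: Ball_def)
  have "operator_on W (\<lambda>x. x)" unfolding operator_on_def by (auto intro!: exI[of _ 1])
  then obtain W' where "W' \<subseteq> W" "closed_inf_subspace W'"
    "\<And>x. x \<in> W' \<Longrightarrow> \<exists>z\<in>Z. norm (x - z) \<le> \<epsilon> * norm x"
    using close_to_subspace[OF HI W(2) insert.prems[of Z], of "\<lambda>x. x" 1 \<epsilon>] \<epsilon> by auto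
  with W show ?case by (intro exI[of _ W']) (auto; blast)
qed

text \<open>Orbits are built from the end: \<open>W\<close> serves the last n steps from any
  starting point in it, and a new first step is put in front by mapping a smaller subspace near
  \<open>W\<close>.\<close>

lemma approximate_orbits_exist:
  fixes A :: "'a::complex_banach set" and T :: "'a \<Rightarrow> 'a"
  assumes HI: "hereditarily_indecomposable (UNIV :: 'a set)" and Zs: "finite Zs"
    "\<And>Z. Z \<in> Zs \<Longrightarrow> closed_inf_subspace Z"
    and A: "closed_inf_subspace A" and T: "operator_on A T"
    and m: "m > 0" "\<And>x. x \<in> A \<Longrightarrow> m * norm x \<le> norm (T x)"
    and "\<epsilon> > 0"
  shows "\<exists>W\<subseteq>A. closed_inf_subspace W \<and> (\<forall>w\<in>W. \<exists>x. x 0 = w \<and> (\<forall>k. x k \<in> A) \<and>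
    (\<forall>k<n. norm (T (x k) - x (Suc k)) \<le> \<epsilon> * norm w \<and> (\<forall>Z\<in>Zs. \<exists>z\<in>Z. norm (x k - z) \<le> \<epsilon> * norm w)))"
  using assms(8)
proof (induction n arbitrary: \<epsilon>)
  case 0
  have "0 \<in> A" using complex_vector.subspace_0[OF closed_inf_subspaceD(1)[OF A]] .
  \<comment> \<open>The default 0 keeps all entries in \<open>A\<close>.\<close>
  then have "\<exists>x. x 0 = w \<and> (\<forall>k. x k \<in> A)" if "w \<in> A" for w
    using that by (intro exI[of _ "\<lambda>k. if k = 0 then w else 0"]) auto
  then show ?case using A by (intro exI[of _ A]) auto
next
  case (Suc n)
  obtain K where K: "K > 0" "\<And>x. x \<in> A \<Longrightarrow> norm (T x) \<le> K * norm x"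
    using operator_on_bound[OF closed_inf_subspaceD(1)[OF A] T] by blast
  have K\<epsilon>: "K + \<epsilon> > 0" using K(1) Suc.prems by simp
  \<comment> \<open>The second point b satisfies norm b <= (K + \<epsilon>) norm w, so errors
    relative to b become errors relative to w.\<close>
  then have "\<epsilon> / (K + \<epsilon>) > 0" using Suc.prems by simp
  from Suc.IH[OF this] obtain W where W: "W \<subseteq> A" "closed_inf_subspace W"
    and orbit: "\<And>w. w \<in> W \<Longrightarrow> \<exists>x. x 0 = w \<and> (\<forall>k. x k \<in> A) \<and>
      (\<forall>k<n. norm (T (x k) - x (Suc k)) \<le> \<epsilon> / (K + \<epsilon>) * norm w \<and>
        (\<forall>Z\<in>Zs. \<exists>z\<in>Z. norm (x k - z) \<le> \<epsilon> / (K + \<epsilon>) * norm w))"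
    by blast
  obtain A1 where A1: "A1 \<subseteq> A" "closed_inf_subspace A1"
    "\<And>x. x \<in> A1 \<Longrightarrow> \<exists>b\<in>W. norm (T x - b) \<le> \<epsilon> * norm x"
    using close_to_subspace[OF HI A W(2) T m Suc.prems] by blast
  obtain A2 where A2: "A2 \<subseteq> A1" "closed_inf_subspace A2"
    "\<And>x Z. x \<in> A2 \<Longrightarrow> Z \<in> Zs \<Longrightarrow> \<exists>z\<in>Z. norm (x - z) \<le> \<epsilon> * norm x"
    using close_to_finitely_many[OF HI Zs A1(2) Suc.prems] by blast
  have "\<exists>x. x 0 = w \<and> (\<forall>k. x k \<in> A) \<and>
    (\<forall>k<Suc n. norm (T (x k) - x (Suc k)) \<le> \<epsilon> * norm w \<and> (\<forall>Z\<in>Zs. \<exists>z\<in>Z. norm (x k - z) \<le> \<epsilon> * norm w))"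
    if w: "w \<in> A2" for w
  proof -
    have wA: "w \<in> A1" "w \<in> A" using w A2(1) A1(1) by auto
    obtain b where b: "b \<in> W" "norm (T w - b) \<le> \<epsilon> * norm w" using A1(3)[OF wA(1)] by blast
    obtain y where y: "y 0 = b" "\<And>k. y k \<in> A"
      "\<And>k. k < n \<Longrightarrow> norm (T (y k) - y (Suc k)) \<le> \<epsilon> / (K + \<epsilon>) * norm b"
      "\<And>k Z. k < n \<Longrightarrow> Z \<in> Zs \<Longrightarrow> \<exists>z\<in>Z. norm (y k - z) \<le> \<epsilon> / (K + \<epsilon>) * norm b"
      using orbit[OF b(1)] by blast
    have "norm b \<le> norm (T w) + norm (T w - b)"
      using norm_triangle_ineq4[of "T w" "T w - b"] by simp
    also have "\<dots> \<le> (K + \<epsilon>) * norm w"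
      using b(2) K(2)[OF wA(2)] by (simp add: distrib_right)
    finally have "\<epsilon> / (K + \<epsilon>) * norm b \<le> \<epsilon> / (K + \<epsilon>) * ((K + \<epsilon>) * norm w)"
      using K\<epsilon> Suc.prems by (intro mult_left_mono) auto
    also have "\<dots> = \<epsilon> * norm w" using K\<epsilon> by simp
    finally have le: "\<epsilon> / (K + \<epsilon>) * norm b \<le> \<epsilon> * norm w" .
    show ?thesis
    proof (intro exI[of _ "case_nat w y"] conjI allI impI ballI)
      fix k show "case_nat w y k \<in> A" using wA y(2) by (cases k) auto
    next
      fix k assume "k < Suc n"
      then show "norm (T (case_nat w y k) - case_nat w y (Suc k)) \<le> \<epsilon> * norm w"
        using b y(1) order_trans[OF y(3) le] by (cases k) auto
    next
      fix k Z assume k: "k < Suc n" "Z \<in> Zs"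
      show "\<exists>z\<in>Z. norm (case_nat w y k - z) \<le> \<epsilon> * norm w"
      proof (cases k)
        case 0
        then show ?thesis using A2(3)[OF w k(2)] by simp
      next
        case (Suc j)
        then obtain z where "z \<in> Z" "norm (y j - z) \<le> \<epsilon> / (K + \<epsilon>) * norm b"
          using y(4)[of j Z] k by auto
        with le Suc show ?thesis by (intro bexI[of _ z]) (simp only: nat.case, linarith)
      qed
    qed simp
  qed
  then show ?case using A2 A1(1) by (intro exI[of _ A2]) auto
qed

text \<open>The limit superior of the norms, for bounded sequences.\<close>

definition limnorm :: "(nat \<Rightarrow> 'a::real_normed_vector) \<Rightarrow> real" where
  "limnorm a = Inf {c. \<forall>\<^sub>F n in sequentially. norm (a n) \<le> c}"

lemma nonneg_if_eventually_norm_le: "\<forall>\<^sub>F n in sequentially. norm (a n) \<le> c \<Longrightarrow> 0 \<le> c"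
proof -
  assume "\<forall>\<^sub>F n in sequentially. norm (a n) \<le> c"
  then obtain n where "norm (a n) \<le> c" unfolding eventually_sequentially by blast
  then show "0 \<le> c" using norm_ge_zero[of "a n"] by linarith
qed

lemma limnorm_le: "\<forall>\<^sub>F n in sequentially. norm (a n) \<le> c \<Longrightarrow> limnorm a \<le> c"
  unfolding limnorm_def
proof (rule cInf_lower)
  show "bdd_below {c. \<forall>\<^sub>F n in sequentially. norm (a n) \<le> c}"
    using nonneg_if_eventually_norm_le[of a] by (intro bdd_belowI[of _ 0]) blast
qed blast

lemma eventually_le_limnorm:
  assumes "\<forall>\<^sub>F n in sequentially. norm (a n) \<le> B" "\<epsilon> > 0"
  shows "\<forall>\<^sub>F n in sequentially. norm (a n) \<le> limnorm a + \<epsilon>"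
proof -
  have "\<exists>c\<in>{c. \<forall>\<^sub>F n in sequentially. norm (a n) \<le> c}. c < limnorm a + \<epsilon>"
    unfolding limnorm_def using assms
    by (intro cInf_lessD) auto
  then obtain c where "\<forall>\<^sub>F n in sequentially. norm (a n) \<le> c" "c < limnorm a + \<epsilon>" by blast
  then show ?thesis by (auto elim: eventually_mono)
qed

text \<open>Transfers every estimate on orbits, up to an error tending to 0, to the
  seminorm.\<close>

lemma limnorm_comparison:
  assumes "\<forall>\<^sub>F n in sequentially. norm (a n) \<le> B" "\<forall>\<^sub>F n in sequentially. norm (b n) \<le> B'"
    and le: "\<forall>\<^sub>F n in sequentially. norm (d n) \<le> s * norm (a n) + t * norm (b n) + e n"
    and "e \<longlonglongrightarrow> 0" "s \<ge> 0" "t \<ge> 0"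
  shows "limnorm d \<le> s * limnorm a + t * limnorm b"
proof (rule field_le_epsilon)
  fix \<epsilon> :: real assume \<epsilon>: "\<epsilon> > 0"
  \<comment> \<open>\<delta> is spent s times on a, t times on b and once on e.\<close>
  define \<delta> where "\<delta> = \<epsilon> / (s + t + 1)"
  have \<delta>: "\<delta> > 0" using \<epsilon> assms(5,6) by (simp add: \<delta>_def)
  have "\<forall>\<^sub>F n in sequentially. e n < \<delta>"
    using assms(4) \<delta> by (rule order_tendstoD)
  with le eventually_le_limnorm[OF assms(1) \<delta>] eventually_le_limnorm[OF assms(2) \<delta>]
  have "\<forall>\<^sub>F n in sequentially. norm (d n) \<le> s * limnorm a + t * limnorm b + \<epsilon>"
  proof eventually_elim
    case (elim n)
    have "s * norm (a n) \<le> s * (limnorm a + \<delta>)" "t * norm (b n) \<le> t * (limnorm b + \<delta>)"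
      using elim assms(5,6) by (auto intro: mult_left_mono)
    with elim have "norm (d n) \<le> s * limnorm a + t * limnorm b + (s + t + 1) * \<delta>"
      by (simp add: algebra_simps)
    also have "(s + t + 1) * \<delta> = \<epsilon>" using assms(5,6) by (simp add: \<delta>_def)
    finally show ?case .
  qed
  then show "limnorm d \<le> s * limnorm a + t * limnorm b + \<epsilon>" by (rule limnorm_le)
qed

text \<open>\<open>X n\<close> is the orbit of a unit vector up to an error of \<open>1 / Suc n\<close> in each of the first \<open>n\<close> steps. A
  polynomial stands for the sequence of its values at \<open>T\<close> applied to these vectors, so the shift is a genuinely
  linear operator although \<open>T\<close> does not map \<open>Y\<close> to itself.\<close>

locale approximate_orbits =
  fixes Y :: "'a::complex_normed_vector set" and T :: "'a \<Rightarrow> 'a" and K :: real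
    and X :: "nat \<Rightarrow> nat \<Rightarrow> 'a"
  assumes Y: "csubspace Y" and T: "operator_on Y T"
    and bound: "x \<in> Y \<Longrightarrow> norm (T x) \<le> K * norm x" and K: "K > 0"
    and in_Y: "X n k \<in> Y" and unit: "norm (X n 0) = 1"
    and step: "k < n \<Longrightarrow> norm (T (X n k) - X n (Suc k)) \<le> 1 / Suc n"
begin

lemma eventually_bounded: "\<exists>B. \<forall>\<^sub>F n in sequentially. norm (X n k) \<le> B"
proof (induction k)
  case 0
  show ?case using unit by (intro exI[of _ 1]) auto
next
  case (Suc k)
  then obtain B where "\<forall>\<^sub>F n in sequentially. norm (X n k) \<le> B" by blast
  then have "\<forall>\<^sub>F n in sequentially. norm (X n (Suc k)) \<le> K * B + 1"
    using eventually_gt_at_top[of k]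
  proof eventually_elim
    case (elim n)
    have "norm (X n (Suc k)) \<le> norm (T (X n k)) + norm (T (X n k) - X n (Suc k))"
      using norm_triangle_ineq4[of "T (X n k)" "T (X n k) - X n (Suc k)"] by simp
    also have "\<dots> \<le> K * B + 1 / Suc n"
      using step[OF elim(2)] order_trans[OF bound[OF in_Y] mult_left_mono[OF elim(1)]] K
      by (intro add_mono) auto
    also have "1 / real (Suc n) \<le> 1" by simp
    finally show ?case by simp
  qed
  then show ?case by blast
qed

definition ev :: "nat \<Rightarrow> complex poly \<Rightarrow> 'a" where
  "ev n p = (\<Sum>i\<le>degree p. coeff p i *\<^sub>C X n i)"

lemma ev_eq:
  assumes "degree p < d"
  shows "ev n p = (\<Sum>i<d. coeff p i *\<^sub>C X n i)"
  unfolding ev_def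
proof (rule sum.mono_neutral_left)
  show "\<forall>i\<in>{..<d} - {..degree p}. coeff p i *\<^sub>C X n i = 0"
    by (simp add: coeff_eq_0)
qed (use assms in auto)

lemma ev_in_Y: "ev n p \<in> Y"
  unfolding ev_def using Y in_Y by (intro complex_vector.subspace_sum complex_vector.subspace_scale)

lemma ev_add: "ev n (p + q) = ev n p + ev n q"
proof -
  define d where "d = Suc (max (degree p) (degree q))"
  have "degree (p + q) < d" using degree_add_le_max[of p q] by (simp add: d_def)
  then show ?thesis
    using ev_eq[of p d n] ev_eq[of q d n] ev_eq[of "p + q" d n]
    by (simp add: d_def scaleC_add_left sum.distrib)
qed

lemma ev_smult: "ev n (smult c p) = c *\<^sub>C ev n p"
proof -
  have "degree (smult c p) < Suc (degree p)" using degree_smult_le[of c p] by simp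
  then show ?thesis
    using ev_eq[of p "Suc (degree p)" n] ev_eq[of "smult c p" "Suc (degree p)" n]
    by (simp add: complex_vector.scale_sum_right scaleC_scaleC del: sum.lessThan_Suc)
qed

lemma ev_shift: "ev n ([:0, 1:] * p) = (\<Sum>i\<le>degree p. coeff p i *\<^sub>C X n (Suc i))"
proof -
  have "degree (pCons 0 p) < Suc (Suc (degree p))" using degree_pCons_le[of 0 p] by simp
  then have "ev n (pCons 0 p) = (\<Sum>i<Suc (Suc (degree p)). coeff (pCons 0 p) i *\<^sub>C X n i)"
    by (rule ev_eq)
  also have "\<dots> = (\<Sum>i<Suc (degree p). coeff p i *\<^sub>C X n (Suc i))"
    by (subst sum.lessThan_Suc_shift) simp
  finally show ?thesis by (simp add: lessThan_Suc_atMost del: sum.lessThan_Suc)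
qed

lemma ev_bounded: "\<exists>B. \<forall>\<^sub>F n in sequentially. norm (ev n p) \<le> B"
proof -
  obtain B where B: "\<And>k. \<forall>\<^sub>F n in sequentially. norm (X n k) \<le> B k"
    using eventually_bounded by metis
  then have "\<forall>\<^sub>F n in sequentially. \<forall>i\<in>{..degree p}. norm (X n i) \<le> B i"
    by (intro eventually_ball_finite) auto
  then have "\<forall>\<^sub>F n in sequentially. norm (ev n p) \<le> (\<Sum>i\<le>degree p. cmod (coeff p i) * B i)"
    by eventually_elim (auto simp: ev_def norm_scaleC intro!: sum_norm_le mult_left_mono)
  then show ?thesis by blast
qed

text \<open>The weight of the orbit errors in p(T) x; it tends to 0 for each fixed p.\<close>

definition err :: "complex poly \<Rightarrow> nat \<Rightarrow> real" where
  "err p n = (\<Sum>i\<le>degree p. cmod (coeff p i)) / Suc n"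

lemma err_tendsto: "(\<lambda>n. C * err p n) \<longlonglongrightarrow> 0"
  unfolding err_def by (rule tendsto_mult_right_zero[OF LIMSEQ_Suc[OF lim_const_over_n]])

lemma norm_sum_le_err:
  assumes "\<And>i. i \<le> degree p \<Longrightarrow> norm (y i) \<le> 1 / Suc n"
  shows "norm (\<Sum>i\<le>degree p. coeff p i *\<^sub>C y i) \<le> err p n"
proof -
  have "norm (\<Sum>i\<le>degree p. coeff p i *\<^sub>C y i) \<le> (\<Sum>i\<le>degree p. cmod (coeff p i) * (1 / Suc n))"
  proof (rule sum_norm_le)
    show "norm (coeff p i *\<^sub>C y i) \<le> cmod (coeff p i) * (1 / Suc n)" if "i \<in> {..degree p}" for i
      unfolding norm_scaleC using assms that by (intro mult_left_mono) auto
  qed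
  then show ?thesis by (simp add: err_def sum_divide_distrib)
qed

lemma ev_shift_close:
  assumes "degree p < n"
  shows "norm (T (ev n p) - ev n ([:0, 1:] * p)) \<le> err p n"
proof -
  have "T (ev n p) - ev n ([:0, 1:] * p) = (\<Sum>i\<le>degree p. coeff p i *\<^sub>C (T (X n i) - X n (Suc i)))"
    unfolding ev_shift unfolding ev_def using in_Y
    by (simp add: operator_on_sum[OF Y T] sum_subtractf complex_vector.scale_right_diff_distrib)
  then show ?thesis using step assms by (simp add: norm_sum_le_err)
qed

definition N :: "complex poly \<Rightarrow> real" where "N p = limnorm (\<lambda>n. ev n p)"

lemma N_comparison:
  assumes "\<forall>\<^sub>F n in sequentially. norm (ev n r) \<le> s * norm (ev n p) + t * norm (ev n q) + e n"
    and "e \<longlonglongrightarrow> 0" "s \<ge> 0" "t \<ge> 0"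
  shows "N r \<le> s * N p + t * N q"
proof -
  obtain B B' where "\<forall>\<^sub>F n in sequentially. norm (ev n p) \<le> B" "\<forall>\<^sub>F n in sequentially. norm (ev n q) \<le> B'"
    using ev_bounded by blast
  then show ?thesis unfolding N_def using assms by (rule limnorm_comparison)
qed

lemma N_triangle: "N (p + q) \<le> N p + N q"
  using N_comparison[of "p + q" 1 p 1 q "\<lambda>_. 0"] by (simp add: ev_add norm_triangle_ineq)

lemma N_smult: "N (smult c p) = cmod c * N p"
proof -
  have le: "N (smult c p) \<le> cmod c * N p" for c p
    using N_comparison[of "smult c p" "cmod c" p 0 p "\<lambda>_. 0"] by (simp add: ev_smult norm_scaleC)
  show ?thesis
  proof (cases "c = 0")
    case True
    have "N p \<le> 2 * N p" for p
      using N_comparison[of p 2 p 0 p "\<lambda>_. 0"] by simp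
    from this[of 0] show ?thesis using le[of 0 0] True by simp
  next
    case False
    have "N p \<le> N (smult c p) / cmod c"
      using le[of "inverse c" "smult c p"] False by (simp add: norm_inverse norm_divide field_simps)
    with le[of c p] False show ?thesis by (simp add: field_simps)
  qed
qed

lemma N_one: "N 1 > 0"
proof (rule ccontr)
  assume "\<not> N 1 > 0"
  moreover have "norm (ev n 1) = 1" for n by (simp add: ev_def scaleC_one unit)
  then have "\<forall>\<^sub>F n in sequentially. 1 \<le> N 1 + 1 / 2"
    using eventually_le_limnorm[of "\<lambda>n. ev n 1" 1 "1/2"] by (simp add: N_def)
  ultimately show False by simp
qed

lemma N_shift: "N ([:0, 1:] * p) \<le> K * N p"
proof -
  have "\<forall>\<^sub>F n in sequentially. norm (ev n ([:0, 1:] * p)) \<le> K * norm (ev n p) + 0 * norm (ev n p) + 1 * err p n"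
    using eventually_gt_at_top[of "degree p"]
  proof eventually_elim
    case (elim n)
    have "norm (ev n ([:0, 1:] * p)) \<le> norm (T (ev n p)) + norm (T (ev n p) - ev n ([:0, 1:] * p))"
      using norm_triangle_ineq4[of "T (ev n p)" "T (ev n p) - ev n ([:0, 1:] * p)"] by simp
    then show ?case using ev_shift_close[OF elim] bound[OF ev_in_Y, of n p] by simp
  qed
  from N_comparison[OF this err_tendsto] K show ?thesis by simp
qed

text \<open>\<open>ev n p\<close> lies within \<open>err p n\<close> of a vector in
  \<open>Z\<close>, where T - c0 is bounded below by m; moving the scalar from c0 to c costs at most
  m / 2.\<close>

lemma N_lower:
  assumes Z: "csubspace Z" "Z \<subseteq> Y"
    and m: "m > 0" "\<And>z. z \<in> Z \<Longrightarrow> m * norm z \<le> norm (T z - c0 *\<^sub>C z)"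
    and close: "\<And>n k. k < n \<Longrightarrow> \<exists>z\<in>Z. norm (X n k - z) \<le> 1 / Suc n"
    and c: "cmod (c - c0) \<le> m / 2"
  shows "m / 2 * N p \<le> N ([:- c, 1:] * p)"
proof -
  \<comment> \<open>m pays for replacing v by z on the left, K and cmod c0 for doing so in T - c0,
    and 1 for the inexact shift.\<close>
  define C where "C = m + K + cmod c0 + 1"
  have main: "m / 2 * norm (ev n p) \<le> norm (ev n ([:- c, 1:] * p)) + C * err p n" if n: "degree p < n" for n
  proof -
    define v where "v = ev n p"
    define u where "u = ev n ([:- c, 1:] * p)"
    obtain y where y: "\<And>k. k < n \<Longrightarrow> y k \<in> Z" "\<And>k. k < n \<Longrightarrow> norm (X n k - y k) \<le> 1 / Suc n"
      using close[of _ n] by metis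
    define z where "z = (\<Sum>i\<le>degree p. coeff p i *\<^sub>C y i)"
    have zZ: "z \<in> Z"
      unfolding z_def using y n Z by (intro complex_vector.subspace_sum complex_vector.subspace_scale) auto
    have inY: "v \<in> Y" "z \<in> Y" "v - z \<in> Y"
      using ev_in_Y zZ Z(2) complex_vector.subspace_diff[OF Y] by (auto simp: v_def)
    have "v - z = (\<Sum>i\<le>degree p. coeff p i *\<^sub>C (X n i - y i))"
      by (simp add: v_def z_def ev_def sum_subtractf complex_vector.scale_right_diff_distrib)
    then have vz: "norm (v - z) \<le> err p n"
      using y n by (simp add: norm_sum_le_err)
    have "[:- c, 1:] * p = [:0, 1:] * p + smult (- c) p" by simp
    then have u: "u = ev n ([:0, 1:] * p) - c *\<^sub>C v"
      unfolding u_def v_def by (simp only: ev_add ev_smult) simp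
    define r where "r = T v - ev n ([:0, 1:] * p)"
    have r: "norm r \<le> err p n" unfolding r_def v_def by (rule ev_shift_close[OF n])
    have "T z - c0 *\<^sub>C z = u + r + (c - c0) *\<^sub>C v - T (v - z) + c0 *\<^sub>C (v - z)"
      unfolding u r_def using operator_on_diff[OF Y T inY(1,2)]
      by (simp add: complex_vector.scale_left_diff_distrib complex_vector.scale_right_diff_distrib)
    then have "norm (T z - c0 *\<^sub>C z) \<le> norm u + norm r + norm ((c - c0) *\<^sub>C v) + norm (T (v - z)) + norm (c0 *\<^sub>C (v - z))"
      by (smt (verit) norm_triangle_ineq norm_triangle_ineq4)
    also have "\<dots> \<le> norm u + err p n + m / 2 * norm v + K * err p n + cmod c0 * err p n"
    proof (intro add_mono)
      show "norm ((c - c0) *\<^sub>C v) \<le> m / 2 * norm v"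
        using mult_right_mono[OF c norm_ge_zero[of v]] by (simp only: norm_scaleC)
      show "norm (T (v - z)) \<le> K * err p n"
        using bound[OF inY(3)] mult_left_mono[OF vz, of K] K by linarith
      show "norm (c0 *\<^sub>C (v - z)) \<le> cmod c0 * err p n"
        unfolding norm_scaleC using vz by (intro mult_left_mono) auto
    qed (use r in auto)
    finally have "m * norm z \<le> norm u + m / 2 * norm v + (1 + K + cmod c0) * err p n"
      using m(2)[OF zZ] by (simp add: algebra_simps)
    moreover have "m * norm v \<le> m * (norm z + err p n)"
      using vz norm_triangle_ineq2[of v z] m(1) by (intro mult_left_mono) auto
    ultimately show ?thesis by (simp add: u_def v_def C_def algebra_simps)
  qed
  have "\<forall>\<^sub>F n in sequentially. norm (ev n p) \<le> 2 / m * norm (ev n ([:- c, 1:] * p))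
      + 0 * norm (ev n p) + 2 / m * C * err p n"
    using eventually_gt_at_top[of "degree p"]
  proof eventually_elim
    case (elim n)
    show ?case using main[OF elim] m(1) by (simp add: field_simps)
  qed
  from N_comparison[OF this err_tendsto] m(1) have "N p \<le> 2 / m * N ([:- c, 1:] * p)" by simp
  then show ?thesis using m(1) by (simp add: field_simps)
qed

end

lemma not_strictly_singularE:
  assumes "operator_on V S" "\<not> strictly_singular_on V S"
  obtains Z m where "Z \<subseteq> V" "closed_inf_subspace Z" "m > 0" "\<And>z. z \<in> Z \<Longrightarrow> m * norm z \<le> norm (S z)"
proof -
  from assms have "\<exists>Z. (Z \<subseteq> V \<and> closed_inf_subspace Z) \<and> isomorphism_onto_image Z S"
    unfolding strictly_singular_on_def by simp
  then obtain Z where Z: "Z \<subseteq> V" "closed_inf_subspace Z" and iso: "isomorphism_onto_image Z S"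
    by (elim exE conjE)
  then have inj: "inj_on S Z" and "operator_on (S ` Z) (inv_into Z S)"
    unfolding isomorphism_onto_image_def by auto
  then obtain K where K: "\<forall>y\<in>S ` Z. norm (inv_into Z S y) \<le> K * norm y"
    unfolding operator_on_def by blast
  \<comment> \<open>\<open>max\<close> guards against a bound K <= 0.\<close>
  have "1 / max K 1 * norm z \<le> norm (S z)" if "z \<in> Z" for z
  proof -
    have "norm z \<le> K * norm (S z)" using bspec[OF K, of "S z"] that inj by simp
    also have "\<dots> \<le> max K 1 * norm (S z)" by (intro mult_right_mono) auto
    finally show ?thesis by (simp add: divide_le_eq mult.commute)
  qed
  then show thesis using that[OF Z, of "1 / max K 1"] by simp
qed

section \<open>The decomposition\<close>

theorem mainTheorem1:
  fixes Y :: "'a::complex_banach set" and T :: "'a \<Rightarrow> 'a"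
  assumes "hereditarily_indecomposable (UNIV :: 'a set)"
    and "closed_inf_subspace Y"
    and "operator_on Y T"
  shows "\<exists>(c :: complex) S. strictly_singular_on Y S \<and> (\<forall>x\<in>Y. T x = c *\<^sub>C x + S x)"
proof (rule ccontr)
  assume contra: "\<not> ?thesis"
  note Y = closed_inf_subspaceD(1)[OF assms(2)]
  obtain K where K: "K > 0" "\<And>x. x \<in> Y \<Longrightarrow> norm (T x) \<le> K * norm x"
    using operator_on_bound[OF Y assms(3)] by blast
  have "\<exists>Z m. Z \<subseteq> Y \<and> closed_inf_subspace Z \<and> m > 0 \<and> (\<forall>z\<in>Z. m * norm z \<le> norm (T z - c *\<^sub>C z))" for c
  proof -
    let ?S = "\<lambda>x. T x - c *\<^sub>C x"
    have "norm (?S x) \<le> (K + cmod c) * norm x" if "x \<in> Y" for x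
      using norm_triangle_ineq4[of "T x" "c *\<^sub>C x"] K(2)[OF that] by (simp add: norm_scaleC distrib_right)
    then have "operator_on Y ?S"
      unfolding operator_on_def
      by (intro conjI exI[of _ "K + cmod c"])
        (auto simp: operator_on_add[OF Y assms(3)] operator_on_scale[OF Y assms(3)] scaleC_add_right
          scaleC_scaleC mult.commute complex_vector.scale_right_diff_distrib)
    moreover have "\<not> strictly_singular_on Y ?S" using contra by force
    ultimately show ?thesis by (rule not_strictly_singularE) blast
  qed
  then obtain Z m where Z: "\<And>c. Z c \<subseteq> Y" "\<And>c. closed_inf_subspace (Z c)" "\<And>c. m c > 0"
    "\<And>c z. z \<in> Z c \<Longrightarrow> m c * norm z \<le> norm (T z - c *\<^sub>C z)"
    by metis
  \<comment> \<open>Radius K + 1 is what \<open>lower\<close> asks for, and m c / 2 is the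
    perturbation of the scalar that \<open>N_lower\<close> tolerates.\<close>
  have "compact (cball (0::complex) (K + 1))" by simp
  moreover have "cball (0::complex) (K + 1) \<subseteq> (\<Union>c\<in>UNIV. ball c (m c / 2))"
  proof
    fix c show "c \<in> (\<Union>c\<in>UNIV. ball c (m c / 2))" using Z(3)[of c] by (intro UN_I[of c]) auto
  qed
  ultimately obtain F where F: "finite F" "cball 0 (K + 1) \<subseteq> (\<Union>c\<in>F. ball c (m c / 2))"
    using compactE_image[of "cball 0 (K + 1)" UNIV "\<lambda>c. ball c (m c / 2)"] by auto
  \<comment> \<open>On \<open>Z 0\<close> the operator T itself is bounded below, as the
    construction of orbits requires.\<close>
  define A where "A = Z 0"
  note A = Z(2)[of 0, folded A_def]
  have AY: "A \<subseteq> Y" using Z(1) by (simp add: A_def)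
  have below: "m 0 * norm x \<le> norm (T x)" if "x \<in> A" for x
    using Z(4)[of x 0] that by (simp add: A_def)
  define orbit where "orbit = (\<lambda>n x. norm (x 0) = 1 \<and> (\<forall>k. x k \<in> A) \<and>
    (\<forall>k<n. norm (T (x k) - x (Suc k)) \<le> 1 / Suc n \<and> (\<forall>V\<in>Z ` F. \<exists>z\<in>V. norm (x k - z) \<le> 1 / Suc n)))"
  have "\<exists>x. orbit n x" for n
  proof -
    have "finite (Z ` F)" "\<And>V. V \<in> Z ` F \<Longrightarrow> closed_inf_subspace V" using F Z(2) by auto
    note orb = approximate_orbits_exist[OF assms(1) this A operator_on_subset[OF Y assms(3) AY] Z(3)[of 0] below,
        of "1 / Suc n" n]
    then obtain W where W: "closed_inf_subspace W" and o: "\<And>w. w \<in> W \<Longrightarrow> \<exists>x. x 0 = w \<and> (\<forall>k. x k \<in> A) \<and>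
      (\<forall>k<n. norm (T (x k) - x (Suc k)) \<le> 1 / Suc n * norm w \<and> (\<forall>V\<in>Z ` F. \<exists>z\<in>V. norm (x k - z) \<le> 1 / Suc n * norm w))"
      by auto
    obtain w where "w \<in> W" "norm w = 1"
      using infinite_dimensional_nonzero closed_inf_subspaceD[OF W] by blast
    with o[of w] show ?thesis by (auto simp: orbit_def)
  qed
  then obtain X where "\<And>n. orbit n (X n)" by metis
  have X: "norm (X n 0) = 1" "X n k \<in> A" "k < n \<Longrightarrow> norm (T (X n k) - X n (Suc k)) \<le> 1 / Suc n"
    "k < n \<Longrightarrow> c \<in> F \<Longrightarrow> \<exists>z\<in>Z c. norm (X n k - z) \<le> 1 / Suc n" for n k c
    using \<open>orbit n (X n)\<close> by (simp_all add: orbit_def del: of_nat_Suc)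
  interpret approximate_orbits Y T K X
    using Y assms(3) K X AY by unfold_locales auto
  \<comment> \<open>The inserted 1 keeps the minimum meaningful whatever \<open>F\<close>
    is.\<close>
  define \<mu> where "\<mu> = Min (insert 1 (m ` F)) / 2"
  have \<mu>: "\<mu> > 0" "\<And>c. c \<in> F \<Longrightarrow> \<mu> \<le> m c / 2"
    using F(1) Z(3) by (auto simp: \<mu>_def)
  \<comment> \<open>Used to verify \<open>lower\<close>, hence proved before the
    interpretation.\<close>
  have nonneg: "N p \<ge> 0" for p
    using N_triangle[of p "smult (- 1) p"] N_smult[of "- 1" p] N_smult[of 0 0] by simp
  interpret poly_seminorm N K \<mu>
  proof
    fix a p assume "cmod a \<le> K + 1"
    then obtain c where c: "c \<in> F" "cmod (a - c) \<le> m c / 2"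
      using F(2) by (force simp: dist_norm norm_minus_commute)
    have "m c / 2 * N p \<le> N ([:- a, 1:] * p)"
      using closed_inf_subspaceD(1)[OF Z(2)] Z X(4)[OF _ c(1)] c(2) by (intro N_lower[of "Z c" "m c" c]) auto
    then show "\<mu> * N p \<le> N ([:- a, 1:] * p)"
      using mult_right_mono[OF \<mu>(2)[OF c(1)] nonneg[of p]] by linarith
  qed (use N_triangle N_smult N_shift \<mu> K in auto)
  show False using seminorm_trivial[of 1] N_one by simp
qed

end
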